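(* Let $Q(x)=\sum_{k=1}^na_kx^{\mu_k}$, where $n\in\mathbb{N}$, $a_k>0$ and $\mu_k\ge1$. Let $\beta\in\mathbb{Z}$, $p=1$ or $p=\infty$, $0<\alpha\le1$ and $u,\delta>0$. Then the equalities $$E(\mathbf{W}^{r,\beta}_{p,1};G_u^{\alpha,Q})_p=\frac4\pi\sum_{k=0}^\infty\frac{(-1)^{k(\beta+1)}}{(2k+1)^{r+1}}\left(1-\frac{Q\left((u-(2k+1)^\alpha)_+\right)}{Q(u)}\right),$$ $$E(\mathbf{W}^{r,\beta}_{p,1};\widetilde G_\delta^{\alpha,Q})_p=\frac4\pi\sum_{k=0}^\infty\frac{(-1)^{k(\beta+1)}}{(2k+1)^{r+1}}\left(1-\frac{Q\left((1-(2k+1)^\alpha\delta)_+\right)}{Q(1)}\right)$$ hold at least in the following cases: 1) $\beta$ is odd, and $r=1$ or $r\ge2$; 2) $\beta$ is even, and $r=2$ or $r\ge3$.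
   Context: $t_+=t$ if $t>0$ and $t_+=0$ if $t\le0$. $L_p$, $1\le p\le\infty$, is the space of $2\pi$-periodic real-valued measurable functions with finite norm $\|f\|_p=(\int_{-\pi}^{\pi}|f(t)|^p\,dt)^{1/p}$ for $p<\infty$ and $\|f\|_\infty=\operatorname{ess\,sup}_{[-\pi,\pi]}|f|$. Fourier coefficients: $\widehat{\varphi}(k)=\frac1{2\pi}\int_{-\pi}^{\pi}\varphi(t)e^{-ikt}\,dt$. $H_p^1=\{\varphi\in L_p:\|\varphi\|_p\le1,\ \widehat\varphi(0)=0\}$. For $r>0$ and $\beta\in\mathbb{R}$ put $$\psi_{r,\beta}(t)=\sum_{k\ne0}\frac{e^{-i\beta\pi\operatorname{sign}(k)/2}}{|k|^r}e^{ikt}=\sum_{k=1}^\infty\frac{2\cos(kt-\beta\pi/2)}{k^r};$$ this function belongs to $L_1$ and the series is its Fourier series. $\mathbf{W}^{r,\beta}_{p,1}$ is the class of all functions $f(x)=\frac1{2\pi}\int_{-\pi}^{\pi}\varphi(x-t)\psi_{r,\beta}(t)\,dt$ with $\varphi\in H_p^1$. For an operator $G$, $E(\mathbf{W}^{r,\beta}_{p,1};G)_p=\sup\{\|f-G(f)\|_p: f\in\mathbf{W}^{r,\beta}_{p,1}\}$. For $Q(x)=\sum_{k=1}^na_kx^{\mu_k}$ with $a_k,\mu_k>0$ (so $Q(0)=0$, $Q(x)>0$ for $x>0$) and $\alpha,u,\delta>0$, define for $f\in L_1$ (the sums are finite) $$G_u^{\alpha,Q}(f)(x)=\sum_{k\in\mathbb{Z}}\frac{Q\left((u-|k|^\alpha)_+\right)}{Q(u)}\widehat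 f(k)e^{ikx},\qquad \widetilde G_\delta^{\alpha,Q}(f)(x)=\sum_{k\in\mathbb{Z}}\frac{Q\left((1-|k|^\alpha\delta)_+\right)}{Q(1)}\widehat f(k)e^{ikx}.$$ *)

theory Defs
  imports "HOL-Probability.Probability"
begin

definition pos_part :: "real \<Rightarrow> real" where
  "pos_part t = (if t > 0 then t else 0)"

text \<open>The norm is extended-real valued, so that having finite norm is a condition.
  It is defined for functions with values in any normed space because
  \<open>f\<close> is real-valued while the means below are written as complex sums.\<close>

definition Lp_norm :: "ereal \<Rightarrow> (real \<Rightarrow> 'a::real_normed_vector) \<Rightarrow> ereal" where
  "Lp_norm p f =
     (if p = \<infinity> then esssup (lebesgue_on {-pi..pi}) (\<lambda>t. ereal (norm (f t)))
      else let I = (\<integral>\<^sup>+t. ennreal (norm (f t) powr real_of_ereal p) \<partial>lebesgue_on {-pi..pi})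
           in if I = \<infinity> then \<infinity> else ereal (enn2real I powr (1 / real_of_ereal p)))"

definition Lp_space :: "ereal \<Rightarrow> (real \<Rightarrow> real) set" where
  "Lp_space p =
     {f. (\<forall>x. f (x + 2 * pi) = f x) \<and> f \<in> borel_measurable lebesgue \<and> Lp_norm p f < \<infinity>}"

definition fourier_coeff :: "(real \<Rightarrow> real) \<Rightarrow> int \<Rightarrow> complex" where
  "fourier_coeff f k =
     1 / (2 * pi) * (LINT t|lebesgue_on {-pi..pi}. f t * exp (- \<i> * k * t))"

definition H1 :: "ereal \<Rightarrow> (real \<Rightarrow> real) set" where
  "H1 p = {\<phi> \<in> Lp_space p. Lp_norm p \<phi> \<le> 1 \<and> fourier_coeff \<phi> 0 = 0}"

text \<open>For \<open>r > 0\<close> the series converges for every \<open>t\<close> outside the null set of multiples of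
  \<open>2 * pi\<close>; for \<open>r \<le> 1\<close> it may diverge there, and the value is then irrelevant.\<close>

definition psi :: "real \<Rightarrow> real \<Rightarrow> real \<Rightarrow> real" where
  "psi r \<beta> t = (\<Sum>k. 2 * cos (real (Suc k) * t - \<beta> * pi / 2) / real (Suc k) powr r)"

definition W_class :: "real \<Rightarrow> real \<Rightarrow> ereal \<Rightarrow> (real \<Rightarrow> real) set" where
  "W_class r \<beta> p =
     (\<lambda>\<phi> x. 1 / (2 * pi) * (LINT t|lebesgue_on {-pi..pi}. \<phi> (x - t) * psi r \<beta> t)) ` H1 p"

definition approx_error ::
  "(real \<Rightarrow> real) set \<Rightarrow> ((real \<Rightarrow> real) \<Rightarrow> real \<Rightarrow> complex) \<Rightarrow> ereal \<Rightarrow> ereal" where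
  "approx_error W G p = (SUP f\<in>W. Lp_norm p (\<lambda>x. complex_of_real (f x) - G f x))"

text \<open>In both means only finitely many terms are nonzero when \<open>Q 0 = 0\<close> and
  \<open>\<alpha>, \<delta> > 0\<close>.\<close>

definition G_mean ::
  "real \<Rightarrow> (real \<Rightarrow> real) \<Rightarrow> real \<Rightarrow> (real \<Rightarrow> real) \<Rightarrow> real \<Rightarrow> complex" where
  "G_mean \<alpha> Q u f x =
     (\<Sum>\<^sub>\<infinity>k::int. complex_of_real (Q (pos_part (u - \<bar>real_of_int k\<bar> powr \<alpha>)) / Q u)
        * fourier_coeff f k * exp (\<i> * k * x))"

definition Gt_mean ::
  "real \<Rightarrow> (real \<Rightarrow> real) \<Rightarrow> real \<Rightarrow> (real \<Rightarrow> real) \<Rightarrow> real \<Rightarrow> complex" where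
  "Gt_mean \<alpha> Q \<delta> f x =
     (\<Sum>\<^sub>\<infinity>k::int. complex_of_real (Q (pos_part (1 - \<bar>real_of_int k\<bar> powr \<alpha> * \<delta>)) / Q 1)
        * fourier_coeff f k * exp (\<i> * k * x))"

end

theory Submission imports Defs begin

text \<open>The multipliers are \<open>c k = Q (pos_part (v - k powr \<alpha> * w)) / Q v\<close>; since \<open>\<alpha> \<le> 1 \<le> \<mu>\<close> they form a
  convex sequence with \<open>c 0 = 1\<close> and finite support.  The deviation of the mean from
  \<open>f\<close> is the convolution of \<open>\<phi>\<close> with the kernel
  \<open>K t = (\<Sum>k\<ge>1. (1 - c k) * 2 * cos (k * t - \<beta> * pi / 2) / k powr r)\<close>.  If there are a constant \<open>C\<close> and
  a square wave \<open>\<tau>\<close> with the sign of \<open>K - C\<close>, then, because \<open>\<phi>\<close> has mean zero and \<open>\<tau>\<close> is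
  antiperiodic, the supremum is the \<open>L\<^sub>1\<close> norm of \<open>K - C\<close> divided by \<open>2 * pi\<close>, for \<open>p = 1\<close>
  and for \<open>p = \<infinity>\<close>, and integrating \<open>\<tau> * K\<close> termwise gives the series.

  For odd \<open>\<beta>\<close> the kernel is a sine series, to be shown nonnegative on \<open>(0, pi)\<close>.  For \<open>r \<ge> 2\<close> this is
  the Fejer-Jackson inequality and summation by parts, as \<open>(1 - c k) / k\<close> decreases.  For
  \<open>r = 1\<close> the series is, up to sign, twice \<open>(pi - t) / 2 - (\<Sum>k\<ge>1. c k * sin (k * t) / k)\<close>, which vanishes at
  \<open>pi\<close> and decreases because the cosine sum of a convex sequence is nonnegative.  For even
  \<open>\<beta>\<close> the kernel is a cosine series whose derivative is of the previous kind with \<open>r - 1\<close> for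
  \<open>r\<close>, so it is monotone and \<open>K - K (pi / 2)\<close> has, up to sign, the sign of \<open>cos\<close>.\<close>

section \<open>Trigonometric sums\<close>

text \<open>Product-to-sum turns \<open>2 * sin (t/2) * cos (k * t)\<close> into a difference of
  consecutive half-integer sines, so the sum telescopes. The product form stays meaningful where
  \<open>sin (t/2) = 0\<close>.\<close>

lemma dirichlet_cos:
  fixes t :: real
  shows "sin (t/2) * (1 + 2 * (\<Sum>k=1..n. cos (real k * t))) = sin ((2 * real n + 1) * (t/2))"
proof (induction n)
  case (Suc n)
  have "2 * sin (t/2) * cos (real (Suc n) * t) =
      sin ((2 * real (Suc n) + 1) * (t/2)) - sin ((2 * real n + 1) * (t/2))"
  proof -
    have *: "t/2 + real (Suc n) * t = (2 * real (Suc n) + 1) * (t/2)"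
      "t/2 - real (Suc n) * t = - ((2 * real n + 1) * (t/2))"
      by (simp_all add: field_simps)
    show ?thesis unfolding mult.assoc sin_times_cos * sin_minus by simp
  qed
  with Suc show ?case by (simp add: algebra_simps)
qed simp

text \<open>Induction on the number of terms, looking only at a minimum point. At an interior one
  the derivative, a cosine sum, vanishes; the Dirichlet formula then shows that the last term is
  nonnegative there, and the remaining sum is so by induction.\<close>

lemma fejer_jackson:
  fixes t :: real
  assumes "0 \<le> t" "t \<le> pi"
  shows "0 \<le> (\<Sum>k=1..n. sin (real k * t) / real k)"
  using assms
proof (induction n arbitrary: t)
  case (Suc n)
  define S where "S m x = (\<Sum>k=1..m. sin (real k * x) / real k)" for m and x :: real
  have S_deriv: "(S m has_real_derivative (\<Sum>k=1..m. cos (real k * x))) (at x)" for m x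
    unfolding S_def
    by (rule derivative_eq_intros refl | simp)+
  have cont: "continuous_on {0..pi} (S (Suc n))"
    using S_deriv by (intro DERIV_continuous_on) (auto intro: has_field_derivative_at_within)
  obtain m where m: "m \<in> {0..pi}" and min: "\<And>x. x \<in> {0..pi} \<Longrightarrow> S (Suc n) m \<le> S (Suc n) x"
    using continuous_attains_inf[OF _ _ cont] by auto
  have "S (Suc n) m \<ge> 0"
  proof (cases "m = 0 \<or> m = pi")
    case True
    have "sin (real k * pi) = 0" for k by simp
    with True show ?thesis by (auto simp: S_def simp del: of_nat_Suc)
  next
    case False
    with m have m: "0 < m" "m < pi" by auto
    have "(\<Sum>k=1..Suc n. cos (real k * m)) = 0"
      by (rule DERIV_local_min[OF S_deriv, of "min m (pi - m)"])
        (use m in \<open>auto intro!: min\<close>)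
    with dirichlet_cos[of m "Suc n"]
    have eq: "sin ((2 * real (Suc n) + 1) * (m/2)) = sin (m/2)"
      by (simp only: mult_zero_right add_0_right mult_1_right)
    have sp: "sin (m/2) > 0" using m by (intro sin_gt_zero) auto
    \<comment> \<open>Equal sines leave the cosines equal up to sign; as \<open>cos (m/2)\<close> is
      positive, it is the larger one in either case.\<close>
    have "(cos ((2 * real (Suc n) + 1) * (m/2)))\<^sup>2 = (cos (m/2))\<^sup>2"
      using eq by (metis cos_squared_eq)
    moreover have "cos (m/2) > 0" using m by (intro cos_gt_zero_pi) auto
    ultimately have le: "cos ((2 * real (Suc n) + 1) * (m/2)) \<le> cos (m/2)"
      by (smt (verit) power2_eq_iff)
    \<comment> \<open>The last term, rewritten with the critical point equation \<open>eq\<close>,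
      becomes a product of two nonnegative factors.\<close>
    have "sin (real (Suc n) * m) = sin ((2 * real (Suc n) + 1) * (m/2) - m/2)"
      by (intro arg_cong[where f = sin]) (simp add: field_simps)
    also have "\<dots> = sin (m/2) * (cos (m/2) - cos ((2 * real (Suc n) + 1) * (m/2)))"
      by (simp only: sin_diff eq) (simp add: algebra_simps)
    also have "\<dots> \<ge> 0" using sp le by simp
    finally have "sin (real (Suc n) * m) \<ge> 0" .
    moreover have "S n m \<ge> 0" using Suc.IH[of m] m by (simp add: S_def)
    ultimately show ?thesis by (simp add: S_def del: of_nat_Suc)
  qed
  with min[of t] Suc.prems show ?case by (force simp: S_def)
qed simp

text \<open>Adding the boundary term \<open>cos ((2n+1)t/2) / ((2n+1) sin (t/2))\<close> to the error turns its
  derivative into one that is dominated by the derivative of \<open>cot (t/2) / (2n+1)\<close>.\<close>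

lemma sawtooth_partial_sum_error:
  fixes t :: real
  assumes "0 < t" "t \<le> pi"
  shows "\<bar>(\<Sum>k=1..n. sin (real k * t) / real k) - (pi - t) / 2\<bar> \<le> 2 / ((2 * real n + 1) * sin (t/2))"
proof -
  define M where "M = 2 * real n + 1"
  have M: "M > 0" by (simp add: M_def)
  define E where "E x = (\<Sum>k=1..n. sin (real k * x) / real k) - (pi - x) / 2 +
    cos (M * (x/2)) / (M * sin (x/2))" for x
  define C where "C x = cos (x/2) / (M * sin (x/2))" for x
  have spos: "sin (x/2) > 0" if "t \<le> x" "x \<le> pi" for x
    using that assms by (intro sin_gt_zero) auto
  define E' where "E' x = - (cos (M * (x/2)) * cos (x/2) / (2 * M * (sin (x/2))\<^sup>2))" for x
  define C' where "C' x = - (1 / (2 * M * (sin (x/2))\<^sup>2))" for x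
  have dE: "(E has_real_derivative E' x) (at x)" if "t \<le> x" "x \<le> pi" for x
  proof -
    note s = spos[OF that]
    have "(E has_real_derivative (\<Sum>k=1..n. cos (real k * x)) + 1/2 +
        ((- sin (M * (x/2)) * (M/2)) * (M * sin (x/2)) - cos (M * (x/2)) * (M * (cos (x/2) / 2)))
          / (M * sin (x/2) * (M * sin (x/2)))) (at x)"
      unfolding E_def using s M
      by (auto intro!: derivative_eq_intros simp: field_simps)
    also have "(\<Sum>k=1..n. cos (real k * x)) + 1/2 = sin (M * (x/2)) / (2 * sin (x/2))"
      using dirichlet_cos[of x n] s unfolding M_def by (simp add: field_simps)
    also have "\<dots> + ((- sin (M * (x/2)) * (M/2)) * (M * sin (x/2)) - cos (M * (x/2)) * (M * (cos (x/2) / 2)))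
          / (M * sin (x/2) * (M * sin (x/2))) = E' x"
      using s M unfolding E'_def by (simp add: divide_simps power2_eq_square)
    finally show ?thesis .
  qed
  have dC: "(C has_real_derivative C' x) (at x)" if "t \<le> x" "x \<le> pi" for x
  proof -
    note s = spos[OF that]
    have "(C has_real_derivative 
        ((- sin (x/2) / 2) * (M * sin (x/2)) - cos (x/2) * (M * (cos (x/2) / 2)))
          / (M * sin (x/2) * (M * sin (x/2)))) (at x)"
      unfolding C_def using s M
      by (auto intro!: derivative_eq_intros simp: field_simps)
    also have "((- sin (x/2) / 2) * (M * sin (x/2)) - cos (x/2) * (M * (cos (x/2) / 2)))
          / (M * sin (x/2) * (M * sin (x/2))) = - (M * ((sin (x/2))\<^sup>2 + (cos (x/2))\<^sup>2)) / (2 * M * M * (sin (x/2))\<^sup>2)"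
      using s M by (simp add: divide_simps power2_eq_square) (simp add: algebra_simps)
    also have "\<dots> = C' x" using M unfolding C'_def by simp
    finally show ?thesis .
  qed
  have E'C': "\<bar>E' x\<bar> \<le> - C' x" for x
  proof -
    have "\<bar>cos (M * (x/2)) * cos (x/2)\<bar> \<le> 1"
      by (simp add: abs_mult mult_le_one)
    then show ?thesis
      unfolding E'_def C'_def using M by (simp add: abs_mult divide_right_mono)
  qed
  \<comment> \<open>Since the absolute value of \<open>E'\<close> is at most \<open>- C'\<close>,
    the difference \<open>E - C\<close> increases and the sum \<open>E + C\<close> decreases. Both
    vanish at \<open>pi\<close>, which leaves \<open>E t\<close> between \<open>- C t\<close> and
    \<open>C t\<close>.\<close>
  have "(E x - C x) \<le> (E pi - C pi) \<and> E pi + C pi \<le> E x + C x" if "t \<le> x" "x \<le> pi" for x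
  proof
    show "(E x - C x) \<le> (E pi - C pi)"
    proof (rule DERIV_nonneg_imp_nondecreasing[of x pi "\<lambda>x. E x - C x"])
      fix y assume "x \<le> y" "y \<le> pi"
      then have "((\<lambda>x. E x - C x) has_real_derivative E' y - C' y) (at y)"
        using that by (intro DERIV_diff dE dC) auto
      with E'C'[of y] show "\<exists>z. ((\<lambda>x. E x - C x) has_real_derivative z) (at y) \<and> 0 \<le> z"
        by (intro exI conjI) auto
    qed (use that in auto)
    show "(E pi + C pi) \<le> (E x + C x)"
    proof (rule DERIV_nonpos_imp_nonincreasing[of x pi "\<lambda>x. E x + C x"])
      fix y assume "x \<le> y" "y \<le> pi"
      then have "((\<lambda>x. E x + C x) has_real_derivative E' y + C' y) (at y)"
        using that by (intro DERIV_add dE dC) auto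
      with E'C'[of y] show "\<exists>z. ((\<lambda>x. E x + C x) has_real_derivative z) (at y) \<and> z \<le> 0"
        by (intro exI conjI) auto
    qed (use that in auto)
  qed
  from this[of t] assms have 1: "E t - C t \<le> E pi - C pi" "E pi + C pi \<le> E t + C t" by auto
  \<comment> \<open>\<open>M\<close> is odd, so the boundary term added in \<open>E\<close> vanishes
    at \<open>pi\<close>.\<close>
  have "cos (M * (pi/2)) = 0"
  proof -
    have "cos (M * (pi/2)) = cos (real n * pi + pi/2)" by (simp add: M_def field_simps)
    then show ?thesis by (simp add: cos_add)
  qed
  moreover have "sin (real k * pi) = 0" for k by simp
  ultimately have "E pi = 0" "C pi = 0" by (simp_all add: E_def C_def)
  with 1 have "\<bar>E t\<bar> \<le> C t" by auto
  \<comment> \<open>The bound \<open>C\<close> and the boundary term removed from \<open>E\<close>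
    each cost at most \<open>1 / (M * sin (t/2))\<close>; hence the constant 2.\<close>
  moreover have "C t \<le> 1 / (M * sin (t/2))"
    unfolding C_def using spos[of t] assms M by (intro divide_right_mono) auto
  moreover have "\<bar>cos (M * (t/2)) / (M * sin (t/2))\<bar> \<le> 1 / (M * sin (t/2))"
    using spos[of t] assms M by (simp add: abs_mult divide_right_mono)
  moreover have "2 / (M * sin (t/2)) = 1 / (M * sin (t/2)) + 1 / (M * sin (t/2))" by simp
  ultimately show ?thesis unfolding E_def M_def[symmetric] by linarith
qed

text \<open>Multiplication of a cosine sum by \<open>1 - cos t\<close> takes second differences of its coefficients.\<close>

lemma convex_cosine_identity:
  fixes c :: "nat \<Rightarrow> real" and t :: real
  shows "(1 - cos t) * (c 0 + 2 * (\<Sum>k=1..n. c k * cos (real k * t))) =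
    (\<Sum>k=1..n. (c (k - 1) - 2 * c k + c (k + 1)) * (1 - cos (real k * t)))
    + (c (Suc n) * cos (real n * t) - c n * cos (real (Suc n) * t) + c n - c (Suc n))"
proof (induction n)
  case 0
  then show ?case by (simp add: algebra_simps)
next
  case (Suc n)
  have "cos (real (Suc (Suc n)) * t) + cos (real n * t) = 2 * cos t * cos (real (Suc n) * t)"
    using cos_add[of "real (Suc n) * t" t] cos_diff[of "real (Suc n) * t" t]
    by (simp add: algebra_simps)
  then have *: "cos (real (Suc (Suc n)) * t) = 2 * cos t * cos (real (Suc n) * t) - cos (real n * t)"
    by linarith
  have "(1 - cos t) * (c 0 + 2 * (\<Sum>k=1..Suc n. c k * cos (real k * t))) =
    (1 - cos t) * (c 0 + 2 * (\<Sum>k=1..n. c k * cos (real k * t))) + 2 * (1 - cos t) * c (Suc n) * cos (real (Suc n) * t)"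
    by (simp add: algebra_simps)
  then show ?case unfolding Suc * by (simp add: algebra_simps)
qed

text \<open>For \<open>n = N\<close> the boundary terms of the identity vanish and each remaining
  summand is a nonnegative second difference times \<open>1 - cos (k * t)\<close>. The factor
  \<open>1 - cos t\<close> is positive and can be cancelled.\<close>

lemma convex_cosine_sum_nonneg:
  fixes c :: "nat \<Rightarrow> real" and t :: real
  assumes "\<And>k. 2 * c (Suc k) \<le> c k + c (Suc (Suc k))" and "\<And>k. k \<ge> N \<Longrightarrow> c k = 0"
    and "cos t < 1"
  shows "0 \<le> c 0 + 2 * (\<Sum>k=1..N. c k * cos (real k * t))"
proof -
  have "0 \<le> (\<Sum>k=1..N. (c (k - 1) - 2 * c k + c (k + 1)) * (1 - cos (real k * t)))"
  proof (intro sum_nonneg mult_nonneg_nonneg)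
    fix k assume "k \<in> {1..N}"
    then show "0 \<le> c (k - 1) - 2 * c k + c (k + 1)" using assms(1)[of "k - 1"] by auto
  qed simp
  then have "0 \<le> (1 - cos t) * (c 0 + 2 * (\<Sum>k=1..N. c k * cos (real k * t)))"
    unfolding convex_cosine_identity by (simp add: assms(2))
  with assms(3) show ?thesis by (simp add: zero_le_mult_iff)
qed

section \<open>Sine and cosine series with multipliers\<close>

text \<open>A crude linear bound suffices later. Up to \<open>pi/3\<close> the cosine is at least
  1/2, so \<open>sin x - x / 4\<close> increases; beyond, the sine is at least 1/2 while
  \<open>x / 4\<close> is at most \<open>pi / 8\<close>, below 1/2.\<close>

lemma sin_ge_quarter:
  fixes x :: real
  assumes "0 \<le> x" "x \<le> pi/2"
  shows "x / 4 \<le> sin x"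
proof (cases "x \<le> pi/3")
  case True
  have "sin 0 - 0 / 4 \<le> sin x - x / 4"
  proof (rule DERIV_nonneg_imp_nondecreasing[OF assms(1)])
    fix y assume y: "0 \<le> y" "y \<le> x"
    have "cos (pi/3) \<le> cos y" using y True by (intro cos_monotone_0_pi_le) auto
    moreover have "((\<lambda>x. sin x - x / 4) has_real_derivative cos y - 1 / 4) (at y)"
      by (auto intro!: derivative_eq_intros)
    ultimately show "\<exists>d. ((\<lambda>x. sin x - x / 4) has_real_derivative d) (at y) \<and> 0 \<le> d"
      by (intro exI conjI) (auto simp: cos_60)
  qed
  then show ?thesis by simp
next
  case False
  have "sin (pi/6) \<le> sin x" using assms False by (intro sin_monotone_2pi_le) auto
  then show ?thesis using assms pi_less_4 by (simp add: sin_30)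
qed

lemma mod_2pi_cases:
  obtains s :: real and m :: int where "t = s + 2 * pi * of_int m" "- pi \<le> s" "s < pi"
proof
  define m where "m = \<lfloor>(t + pi) / (2 * pi)\<rfloor>"
  have "of_int m \<le> (t + pi) / (2 * pi)" "(t + pi) / (2 * pi) < of_int m + 1"
    unfolding m_def by linarith+
  then show "- pi \<le> t - 2 * pi * of_int m" "t - 2 * pi * of_int m < pi"
    using pi_gt_zero by (simp_all add: field_simps)
qed simp

lemma sin_mult_periodic: "sin (real k * (s + 2 * pi * of_int m)) = sin (real k * s)"
  and cos_mult_periodic: "cos (real k * (s + 2 * pi * of_int m) - \<theta>) = cos (real k * s - \<theta>)"
proof -
  have *: "real k * (s + 2 * pi * of_int m) = real k * s + 2 * pi * of_int (int k * m)"
    by (simp add: algebra_simps)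
  show "sin (real k * (s + 2 * pi * of_int m)) = sin (real k * s)"
    unfolding * by (simp add: sin_add del: of_int_mult)
  show "cos (real k * (s + 2 * pi * of_int m) - \<theta>) = cos (real k * s - \<theta>)"
    unfolding * by (simp add: cos_add cos_diff sin_add del: of_int_mult)
qed

text \<open>A bound uniform in \<open>n\<close> and \<open>t\<close> is what dominated convergence
  asks for when \<open>r = 1\<close>, where the series does not converge absolutely. For small
  \<open>n * t\<close> the terms are bounded by \<open>t\<close> each; otherwise the distance to the
  sawtooth is controlled.\<close>

lemma sawtooth_partial_sum_bounded: "\<bar>\<Sum>k=1..n. sin (real k * t) / real k\<bar> \<le> 10"
proof -
  have pos: "\<bar>\<Sum>k=1..n. sin (real k * t) / real k\<bar> \<le> 10" if t: "0 < t" "t \<le> pi" for t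
  proof (cases "real n * t \<le> 1")
    case True
    have "\<bar>\<Sum>k=1..n. sin (real k * t) / real k\<bar> \<le> (\<Sum>k=1..n. t)"
    proof (intro order.trans[OF sum_abs] sum_mono)
      fix k assume "k \<in> {1..n}"
      moreover have "\<bar>sin (real k * t)\<bar> \<le> real k * t"
        using abs_sin_x_le_abs_x[of "real k * t"] t by simp
      ultimately show "\<bar>sin (real k * t) / real k\<bar> \<le> t" by (simp add: field_simps)
    qed
    with True show ?thesis by simp
  next
    case False
    \<comment> \<open>From \<open>sin (t/2) \<ge> t/8\<close> and \<open>n * t > 1\<close> the error
      is at most 8; the sawtooth itself lies between 0 and 2, hence the bound 10.\<close>
    have "t / 8 \<le> sin (t / 2)" using sin_ge_quarter[of "t/2"] t by simp
    moreover have "2 \<le> (2 * real n + 1) * t" using False t by (simp add: algebra_simps)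
    then have "1/4 \<le> (2 * real n + 1) * (t / 8)" by simp
    ultimately have "1/4 \<le> (2 * real n + 1) * sin (t / 2)"
      by (smt (verit) mult_left_mono of_nat_0_le_iff)
    then have "2 / ((2 * real n + 1) * sin (t / 2)) \<le> 8"
      by (simp add: divide_simps mult_ac)
    moreover have "pi < 4" using pi_less_4 .
    moreover have "\<bar>X\<bar> \<le> 10" if "\<bar>X - Y\<bar> \<le> e" "e \<le> 8" "0 \<le> Y" "Y \<le> 2" for X Y e :: real
      using that by linarith
    ultimately show ?thesis
      using sawtooth_partial_sum_error[OF t, of n] t by simp
  qed
  obtain s m where sm: "t = s + 2 * pi * of_int m" "- pi \<le> s" "s < pi"
    using mod_2pi_cases by blast
  consider "s > 0" | "s = 0" | "s < 0" by linarith
  then have "\<bar>\<Sum>k=1..n. sin (real k * s) / real k\<bar> \<le> 10"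
  proof cases
    case 3
    have "(\<Sum>k=1..n. sin (real k * (-s)) / real k) = - (\<Sum>k=1..n. sin (real k * s) / real k)"
      by (simp add: sum_negf)
    with pos[of "-s"] 3 sm show ?thesis by (metis abs_minus_cancel neg_0_less_iff_less minus_le_iff)
  qed (use pos[of s] sm in auto)
  then show ?thesis unfolding sm(1) sin_mult_periodic .
qed

lemma sawtooth_error_bound_tendsto_0:
  assumes "x > 0"
  shows "(\<lambda>n. 2 / ((2 * real n + 1) * x)) \<longlonglongrightarrow> 0"
  using assms by real_asymp

lemma sawtooth_convergent: "convergent (\<lambda>n. \<Sum>k=1..n. sin (real k * t) / real k)"
proof -
  have pos: "convergent (\<lambda>n. \<Sum>k=1..n. sin (real k * t) / real k)" if t: "0 < t" "t \<le> pi" for t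
  proof -
    have "sin (t/2) > 0" using t by (intro sin_gt_zero) auto
    have "(\<lambda>n. (\<Sum>k=1..n. sin (real k * t) / real k) - (pi - t) / 2) \<longlonglongrightarrow> 0"
      by (rule Lim_null_comparison[OF _ sawtooth_error_bound_tendsto_0])
        (use \<open>sin (t/2) > 0\<close> sawtooth_partial_sum_error[OF t] in auto)
    then show ?thesis by (metis LIM_zero_iff convergentI)
  qed
  obtain s m where sm: "t = s + 2 * pi * of_int m" "- pi \<le> s" "s < pi"
    using mod_2pi_cases by blast
  consider "s > 0" | "s = 0" | "s < 0" by linarith
  then have "convergent (\<lambda>n. \<Sum>k=1..n. sin (real k * s) / real k)"
  proof cases
    case 3
    have "convergent (\<lambda>n. - (\<Sum>k=1..n. sin (real k * (-s)) / real k))"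
      using pos[of "-s"] 3 sm by (subst convergent_minus_iff [symmetric]) auto
    then show ?thesis by (simp add: sum_negf)
  qed (use pos[of s] sm in \<open>auto simp: convergent_const\<close>)
  then show ?thesis unfolding sm(1) sin_mult_periodic .
qed

lemma summable_Suc_powr:
  assumes "r > 1"
  shows "summable (\<lambda>k. 1 / real (Suc k) powr r)"
proof -
  have "summable (\<lambda>k. real k powr (- r))" using assms by (subst summable_real_powr_iff) auto
  then have "summable (\<lambda>k. real (Suc k) powr (- r))" by (subst summable_Suc_iff)
  then show ?thesis by (simp add: powr_minus_divide)
qed

text \<open>For \<open>r \<ge> 2\<close> the series is dominated by a convergent one. For
  \<open>r = 1\<close> the condition \<open>cos \<theta> = 0\<close> leaves a pure sine series, a
  multiple of the sawtooth series; a cosine part would be unbounded at 0.\<close>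

lemma trig_series_bounded_convergent:
  fixes r \<theta> :: real
  assumes "r = 1 \<and> cos \<theta> = 0 \<or> r \<ge> 2"
  shows "\<exists>B. \<forall>n t. \<bar>\<Sum>k=1..n. 2 * cos (real k * t - \<theta>) / real k powr r\<bar> \<le> B"
    and "convergent (\<lambda>n. \<Sum>k=1..n. 2 * cos (real k * t - \<theta>) / real k powr r)"
proof -
  have "(\<exists>B. \<forall>n t. \<bar>\<Sum>k=1..n. 2 * cos (real k * t - \<theta>) / real k powr r\<bar> \<le> B)
    \<and> convergent (\<lambda>n. \<Sum>k=1..n. 2 * cos (real k * t - \<theta>) / real k powr r)"
  proof (cases "r \<ge> 2")
    case True
    have s: "summable (\<lambda>k. 2 * (1 / real (Suc k) powr r))"
      using True by (intro summable_mult summable_Suc_powr) auto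
    have le: "\<bar>2 * cos (real (Suc k) * t - \<theta>) / real (Suc k) powr r\<bar> \<le> 2 * (1 / real (Suc k) powr r)" for k t
      by (simp add: abs_mult divide_right_mono del: of_nat_Suc)
    have "\<bar>\<Sum>k=1..n. 2 * cos (real k * t - \<theta>) / real k powr r\<bar> \<le> (\<Sum>k. 2 * (1 / real (Suc k) powr r))" for n t
    proof -
      have "\<bar>\<Sum>k=1..n. 2 * cos (real k * t - \<theta>) / real k powr r\<bar> =
        \<bar>\<Sum>k<n. 2 * cos (real (Suc k) * t - \<theta>) / real (Suc k) powr r\<bar>"
        by (simp add: sum.atLeast1_atMost_eq)
      also have "\<dots> \<le> (\<Sum>k<n. 2 * (1 / real (Suc k) powr r))"
        by (intro order.trans[OF sum_abs] sum_mono le)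
      also have "\<dots> \<le> (\<Sum>k. 2 * (1 / real (Suc k) powr r))"
        by (intro sum_le_suminf s) auto
      finally show ?thesis .
    qed
    moreover have "summable (\<lambda>k. 2 * cos (real (Suc k) * t - \<theta>) / real (Suc k) powr r)"
      by (rule summable_comparison_test'[OF s, of 0]) (use le in \<open>simp del: of_nat_Suc\<close>)
    then have "convergent (\<lambda>n. \<Sum>k=1..n. 2 * cos (real k * t - \<theta>) / real k powr r)"
      by (simp add: summable_iff_convergent sum.atLeast1_atMost_eq)
    ultimately show ?thesis by blast
  next
    case False
    with assms have "r = 1" "cos \<theta> = 0" by auto
    then have eq: "(\<Sum>k=1..n. 2 * cos (real k * t - \<theta>) / real k powr r) =
      2 * sin \<theta> * (\<Sum>k=1..n. sin (real k * t) / real k)" for n t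
      by (auto simp: cos_diff sum_distrib_left intro!: sum.cong)
    have "\<bar>2 * sin \<theta> * (\<Sum>k=1..n. sin (real k * t) / real k)\<bar> \<le> 2 * 10" for n t
      unfolding abs_mult by (intro mult_mono sawtooth_partial_sum_bounded) auto
    moreover have "convergent (\<lambda>n. 2 * sin \<theta> * (\<Sum>k=1..n. sin (real k * t) / real k))"
      by (intro convergent_mult convergent_const sawtooth_convergent)
    ultimately show ?thesis unfolding eq by blast
  qed
  then show "\<exists>B. \<forall>n t. \<bar>\<Sum>k=1..n. 2 * cos (real k * t - \<theta>) / real k powr r\<bar> \<le> B"
    and "convergent (\<lambda>n. \<Sum>k=1..n. 2 * cos (real k * t - \<theta>) / real k powr r)" by auto
qed

text \<open>Summation by parts in inductive form. The claim is strengthened to the lower bound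
  \<open>d n\<close> times the unweighted sum, which persists because lowering the weight of a
  nonnegative sum lowers the product.\<close>

lemma abel_sum_nonneg:
  fixes d a :: "nat \<Rightarrow> real"
  assumes "\<And>k. k \<ge> 1 \<Longrightarrow> d (Suc k) \<le> d k" "\<And>k. k \<ge> 1 \<Longrightarrow> 0 \<le> d k" "\<And>n. 0 \<le> (\<Sum>k=1..n. a k)"
  shows "0 \<le> (\<Sum>k=1..n. d k * a k)"
proof -
  have "d n * (\<Sum>k=1..n. a k) \<le> (\<Sum>k=1..n. d k * a k)" for n
  proof (induction n)
    case (Suc n)
    have "d (Suc n) * (\<Sum>k=1..n. a k) \<le> d n * (\<Sum>k=1..n. a k)"
      using assms(1)[of n] assms(3)[of n] by (cases "n = 0") (auto intro: mult_right_mono)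
    with Suc show ?case by (simp add: algebra_simps)
  qed simp
  moreover have "0 \<le> d n * (\<Sum>k=1..n. a k)"
    using assms(2)[of n] assms(3)[of n] by (cases "n = 0") auto
  ultimately show ?thesis by (meson order.trans)
qed

text \<open>Convexity and vanishing from \<open>N\<close> on already force a decreasing sequence
  with values between 0 and 1, and every sum against \<open>c\<close> is finite.\<close>

locale convex_multiplier =
  fixes c :: "nat \<Rightarrow> real" and N :: nat
  assumes c_0: "c 0 = 1"
    and c_convex: "\<And>k. 2 * c (Suc k) \<le> c k + c (Suc (Suc k))"
    and c_zero: "\<And>k. k \<ge> N \<Longrightarrow> c k = 0"
begin

text \<open>By convexity the increments grow with the index, and they are eventually 0, so none is
  positive.\<close>

lemma c_Suc_le: "c (Suc k) \<le> c k"
proof -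
  have "c (Suc k) - c k \<le> c (Suc (k + j)) - c (k + j)" for j
  proof (induction j)
    case (Suc j)
    with c_convex[of "k + j"] show ?case by simp
  qed simp
  from this[of N] show ?thesis by (simp add: c_zero)
qed

lemma c_le_1: "c k \<le> 1"
  using lift_Suc_antimono_le[of c 0 k] c_Suc_le by (simp add: c_0)

lemma c_nonneg: "0 \<le> c k"
  using lift_Suc_antimono_le[of c k "N + k"] c_Suc_le by (simp add: c_zero)

text \<open>\<open>(1 - c k) / k\<close> is the mean of the first \<open>k\<close> decrements of
  \<open>c\<close>. Convexity makes the decrements decrease, so the next one is at most this mean,
  which is the inequality proved by induction.\<close>

lemma deficit_ratio_antimono:
  assumes "k \<ge> 1"
  shows "(1 - c (Suc k)) / real (Suc k) \<le> (1 - c k) / real k"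
proof -
  have "real k * (c k - c (Suc k)) \<le> 1 - c k" for k
  proof (induction k)
    case (Suc k)
    have "real (Suc k) * (c (Suc k) - c (Suc (Suc k))) \<le> real (Suc k) * (c k - c (Suc k))"
      by (intro mult_left_mono) (use c_convex[of k] in auto)
    with Suc show ?case by (simp add: algebra_simps)
  qed (simp add: c_0)
  from this[of k] show ?thesis using assms by (simp add: field_simps)
qed

text \<open>For \<rho> = 1 the partial sums are nonnegative only up to the error of the sawtooth
  expansion. The explicit error term serves twice: it disappears in the limit, and it bounds
  derivatives of partial cosine sums.\<close>

lemma sine_sum_lower_bound:
  assumes "\<rho> = 1 \<or> \<rho> \<ge> 2" "0 < t" "t \<le> pi" "n \<ge> N"
  shows "- (2 / ((2 * real n + 1) * sin (t/2))) \<le> (\<Sum>k=1..n. (1 - c k) / real k powr \<rho> * sin (real k * t))"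
proof (cases "\<rho> \<ge> 2")
  case True
  \<comment> \<open>The weights against the terms \<open>sin (k * t) / k\<close> are a product of
    two decreasing nonnegative factors, the second because \<open>\<rho> \<ge> 2\<close>.\<close>
  have "0 \<le> (\<Sum>k=1..n. ((1 - c k) / real k * real k powr (2 - \<rho>)) * (sin (real k * t) / real k))"
  proof (rule abel_sum_nonneg)
    fix k :: nat assume k: "k \<ge> 1"
    have "real (Suc k) powr (2 - \<rho>) \<le> real k powr (2 - \<rho>)"
      using True k by (intro powr_mono2') auto
    then show "(1 - c (Suc k)) / real (Suc k) * real (Suc k) powr (2 - \<rho>) \<le> (1 - c k) / real k * real k powr (2 - \<rho>)"
      by (intro mult_mono deficit_ratio_antimono k) (use c_le_1 in auto)
    show "0 \<le> (1 - c k) / real k * real k powr (2 - \<rho>)" using c_le_1 by simp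
  next
    show "0 \<le> (\<Sum>k=1..n. sin (real k * t) / real k)" for n
      using assms by (intro fejer_jackson) auto
  qed
  also have "\<dots> = (\<Sum>k=1..n. (1 - c k) / real k powr \<rho> * sin (real k * t))"
  proof (intro sum.cong refl)
    fix k assume "k \<in> {1..n}"
    then have "real k powr (2 - \<rho>) = real k * real k / real k powr \<rho>"
      by (simp add: powr_diff power2_eq_square)
    with \<open>k \<in> {1..n}\<close> show "((1 - c k) / real k * real k powr (2 - \<rho>)) * (sin (real k * t) / real k) =
        (1 - c k) / real k powr \<rho> * sin (real k * t)" by simp
  qed
  moreover have "sin (t/2) > 0" using assms by (intro sin_gt_zero) auto
  then have "0 \<le> 2 / ((2 * real n + 1) * sin (t/2))" by auto
  ultimately show ?thesis by linarith
next
  case False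
  with assms have "\<rho> = 1" by auto
  \<comment> \<open>\<open>D\<close> is the limit of the partial sums. The slope of
    \<open>(pi - x) / 2\<close> supplies the constant term \<open>c 0 = 1\<close>, so that the
    derivative of \<open>D\<close> is minus half of the full convex cosine sum.\<close>
  define D where "D x = (pi - x) / 2 - (\<Sum>k=1..N. c k * sin (real k * x) / real k)" for x
  have "D pi \<le> D t"
  proof (rule DERIV_nonpos_imp_decreasing_open[OF \<open>t \<le> pi\<close>])
    fix x assume x: "t < x" "x < pi"
    have "(D has_real_derivative - (c 0 + 2 * (\<Sum>k=1..N. c k * cos (real k * x))) / 2) (at x)"
      unfolding D_def c_0
      by (rule derivative_eq_intros refl sum.cong | simp add: sum_distrib_left sum_distrib_right mult_ac)+
    moreover have "cos x < 1" using x assms cos_monotone_0_pi[of 0 x] by simp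
    then have "0 \<le> c 0 + 2 * (\<Sum>k=1..N. c k * cos (real k * x))"
      by (intro convex_cosine_sum_nonneg c_convex c_zero)
    ultimately show "\<exists>y. (D has_real_derivative y) (at x) \<and> y \<le> 0" by (intro exI conjI) auto
  next
    show "continuous_on {t..pi} D" unfolding D_def by (intro continuous_intros) auto
  qed
  moreover have "sin (real k * pi) = 0" for k by simp
  then have "D pi = 0" by (simp add: D_def)
  moreover have "(\<Sum>k=1..n. (1 - c k) / real k powr \<rho> * sin (real k * t)) =
    (\<Sum>k=1..n. sin (real k * t) / real k) - (\<Sum>k=1..n. c k * sin (real k * t) / real k)"
    unfolding sum_subtractf[symmetric] by (intro sum.cong refl) (simp add: \<open>\<rho> = 1\<close> field_simps)
  moreover have "(\<Sum>k=1..n. c k * sin (real k * t) / real k) = (\<Sum>k=1..N. c k * sin (real k * t) / real k)"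
    using assms by (intro sum.mono_neutral_right) (auto simp: c_zero)
  ultimately show ?thesis
    using sawtooth_partial_sum_error[OF assms(2,3), of n] unfolding D_def by linarith
qed

lemma sine_series_nonneg:
  assumes "\<rho> = 1 \<or> \<rho> \<ge> 2" "0 < t" "t \<le> pi"
    and "(\<lambda>n. \<Sum>k=1..n. (1 - c k) / real k powr \<rho> * sin (real k * t)) \<longlonglongrightarrow> L"
  shows "0 \<le> L"
proof -
  have "sin (t/2) > 0" using assms by (intro sin_gt_zero) auto
  then have "(\<lambda>n. - (2 / ((2 * real n + 1) * sin (t/2)))) \<longlonglongrightarrow> - 0"
    by (intro tendsto_minus sawtooth_error_bound_tendsto_0)
  moreover have "\<forall>\<^sub>F n in sequentially. - (2 / ((2 * real n + 1) * sin (t/2))) \<le>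
      (\<Sum>k=1..n. (1 - c k) / real k powr \<rho> * sin (real k * t))"
    using eventually_ge_at_top[of N] by eventually_elim (intro sine_sum_lower_bound assms)
  ultimately show ?thesis using tendsto_le[OF sequentially_bot assms(4)] by fastforce
qed

text \<open>The limit is not differentiated. The mean value theorem is applied to partial sums,
  whose derivative is minus a sine sum with exponent \<open>r - 1\<close>, equal to 1 or at least 2;
  the error tends to 0.\<close>

lemma cosine_series_antimono:
  assumes "r = 2 \<or> r \<ge> 3" "0 < s" "s \<le> t" "t \<le> pi"
    and "(\<lambda>n. \<Sum>k=1..n. (1 - c k) / real k powr r * cos (real k * s)) \<longlonglongrightarrow> Ls"
    and "(\<lambda>n. \<Sum>k=1..n. (1 - c k) / real k powr r * cos (real k * t)) \<longlonglongrightarrow> Lt"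
  shows "Lt \<le> Ls"
proof (cases "s = t")
  case True
  with assms(5,6) show ?thesis using LIMSEQ_unique by blast
next
  case False
  with assms have st: "s < t" by simp
  define C where "C n x = (\<Sum>k=1..n. (1 - c k) / real k powr r * cos (real k * x))" for n and x :: real
  have sp: "sin (s/2) > 0" using assms by (intro sin_gt_zero) auto
  have "C n t - C n s \<le> (t - s) * (2 / ((2 * real n + 1) * sin (s/2)))" if n: "n \<ge> N" for n
  proof -
    have "(C n has_real_derivative - (\<Sum>k=1..n. (1 - c k) / real k powr (r - 1) * sin (real k * x))) (at x)" for x
    proof -
      have "(C n has_real_derivative (\<Sum>k=1..n. (1 - c k) / real k powr r * (- sin (real k * x) * real k))) (at x)"
        unfolding C_def
        by (auto intro!: derivative_eq_intros sum.cong simp: mult_ac simp del: mult_minus_left mult_minus_right)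
      moreover have "(\<Sum>k=1..n. (1 - c k) / real k powr r * (- sin (real k * x) * real k)) =
          - (\<Sum>k=1..n. (1 - c k) / real k powr (r - 1) * sin (real k * x))"
        unfolding sum_negf[symmetric] by (intro sum.cong) (auto simp: powr_diff)
      ultimately show ?thesis by simp
    qed
    with MVT2[OF st, of "C n" "\<lambda>x. - (\<Sum>k=1..n. (1 - c k) / real k powr (r - 1) * sin (real k * x))"] obtain z where z: "s < z" "z < t"
      "C n t - C n s = (t - s) * - (\<Sum>k=1..n. (1 - c k) / real k powr (r - 1) * sin (real k * z))" by blast
    \<comment> \<open>The intermediate point \<open>z\<close> depends on \<open>n\<close>; replacing
      it by \<open>s\<close> makes the error bound uniform on the interval.\<close>
    have "sin (s/2) \<le> sin (z/2)" using z assms by (intro sin_monotone_2pi_le) auto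
    then have "2 / ((2 * real n + 1) * sin (z/2)) \<le> 2 / ((2 * real n + 1) * sin (s/2))"
      using sp by (intro divide_left_mono mult_left_mono mult_pos_pos) auto
    moreover have "- (2 / ((2 * real n + 1) * sin (z/2))) \<le>
        (\<Sum>k=1..n. (1 - c k) / real k powr (r - 1) * sin (real k * z))"
      using assms z n by (intro sine_sum_lower_bound) auto
    ultimately show ?thesis unfolding z(3) using st by (intro mult_left_mono) auto
  qed
  then have ev: "\<forall>\<^sub>F n in sequentially. C n t - C n s \<le> (t - s) * (2 / ((2 * real n + 1) * sin (s/2)))"
    using eventually_sequentially by blast
  have C: "(\<lambda>n. C n t - C n s) \<longlonglongrightarrow> Lt - Ls"
    unfolding C_def by (intro tendsto_diff assms)
  have "(\<lambda>n. (t - s) * (2 / ((2 * real n + 1) * sin (s/2)))) \<longlonglongrightarrow> (t - s) * 0"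
    by (intro tendsto_mult tendsto_const sawtooth_error_bound_tendsto_0 sp)
  from tendsto_le[OF sequentially_bot this C ev] show ?thesis by simp
qed

end

section \<open>Integration over a period\<close>

abbreviation period_measure :: "real measure" where
  "period_measure \<equiv> lebesgue_on {-pi..pi}"

interpretation period: finite_measure period_measure
  by (rule finite_measure_lebesgue_on) simp

interpretation period_pair: pair_sigma_finite period_measure period_measure ..

lemma period_integrable_bounded:
  fixes f :: "real \<Rightarrow> 'a::{banach, second_countable_topology}"
  assumes "f \<in> borel_measurable period_measure" "\<And>x. norm (f x) \<le> B"
  shows "integrable period_measure f"
  using assms by (intro period.integrable_const_bound) auto

lemma borel_imp_period_measurable:
  "f \<in> borel_measurable borel \<Longrightarrow> f \<in> borel_measurable period_measure"
  by (simp add: measurable_completion measurable_restrict_space1)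

lemma period_integrable_bounded_borel:
  fixes f :: "real \<Rightarrow> 'a::{banach, second_countable_topology}"
  assumes "f \<in> borel_measurable borel" "\<And>x. norm (f x) \<le> B"
  shows "integrable period_measure f"
  using assms by (intro period_integrable_bounded borel_imp_period_measurable)

text \<open>Bridge to the gauge integral, for which substitution is used below. Integrability and
  value are transferred together.\<close>

lemma period_integral_iff:
  fixes F :: "real \<Rightarrow> real"
  shows "integrable period_measure F \<and> integral\<^sup>L period_measure F = v \<longleftrightarrow>
    F absolutely_integrable_on {-pi..pi} \<and> integral {-pi..pi} F = v"
proof -
  have "integrable period_measure F \<longleftrightarrow> F absolutely_integrable_on {-pi..pi}"
    by (simp add: set_integrable_def integrable_restrict_space)
  then show ?thesis
    using lebesgue_integral_eq_integral[of "{-pi..pi}" F] by auto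
qed

lemma absolutely_integrable_translate:
  fixes F :: "real \<Rightarrow> real"
  assumes "F absolutely_integrable_on {c + a..d + a}"
  shows "(\<lambda>x. F (x + a)) absolutely_integrable_on {c..d} \<and>
    integral {c..d} (\<lambda>x. F (x + a)) = integral {c + a..d + a} F"
proof -
  have "((\<lambda>x. x + a) has_field_derivative 1) (at x within {c..d})" for x
    by (auto intro!: derivative_eq_intros)
  from has_absolute_integral_change_of_variables_1'[of "{c..d}" "\<lambda>x. x + a" "\<lambda>_. 1" F
      "integral {c + a..d + a} F", OF _ this] assms
  show ?thesis by simp
qed

lemma absolutely_integrable_combine_interval:
  fixes F :: "real \<Rightarrow> real"
  assumes "F absolutely_integrable_on {a..b}" "F absolutely_integrable_on {b..c}" "a \<le> b" "b \<le> c"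
  shows "F absolutely_integrable_on {a..c} \<and> integral {a..c} F = integral {a..b} F + integral {b..c} F"
proof
  have "{a..c} = {a..b} \<union> {b..c}" using assms by auto
  then show "F absolutely_integrable_on {a..c}"
    using assms by (auto intro: set_integrable_Un)
  then have "F integrable_on {a..c}" using set_lebesgue_integral_eq_integral(1) by blast
  then show "integral {a..c} F = integral {a..b} F + integral {b..c} F"
    using Henstock_Kurzweil_Integration.integral_combine[of a b c F] assms by simp
qed

lemma periodic_int:
  fixes F :: "real \<Rightarrow> 'a"
  assumes "\<And>x. F (x + 2 * pi) = F x"
  shows "F (x + 2 * pi * of_int m) = F x"
proof -
  have nat: "F (x + 2 * pi * real n) = F x" for x n
  proof (induction n)
    case (Suc n)
    have "F (x + 2 * pi * real (Suc n)) = F (x + 2 * pi * real n + 2 * pi)"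
      by (simp add: algebra_simps)
    then show ?case by (simp only: assms Suc)
  qed simp
  show ?thesis
  proof (cases "m \<ge> 0")
    case True
    with nat[of x "nat m"] show ?thesis by simp
  next
    case False
    with nat[of "x + 2 * pi * of_int m" "nat (- m)"] show ?thesis by (simp add: algebra_simps)
  qed
qed

text \<open>The shift is reduced to some \<open>b\<close> between 0 and \<open>2 * pi\<close>. The
  period is then cut at \<open>pi - b\<close>, and the part pushed beyond \<open>pi\<close> is moved
  back by one period.\<close>

lemma periodic_integral_translate:
  fixes F :: "real \<Rightarrow> real"
  assumes per: "\<And>x. F (x + 2 * pi) = F x" and F: "integrable period_measure F"
  shows "integrable period_measure (\<lambda>x. F (x + a)) \<and>
    (LINT x|period_measure. F (x + a)) = integral\<^sup>L period_measure F"
proof -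
  define m where "m = \<lfloor>a / (2 * pi)\<rfloor>"
  define b where "b = a - 2 * pi * of_int m"
  have "of_int m \<le> a / (2 * pi)" "a / (2 * pi) < of_int m + 1"
    unfolding m_def by linarith+
  then have b: "0 \<le> b" "b \<le> 2 * pi"
    using pi_gt_zero by (simp_all add: field_simps b_def)
  have "F (x + a) = F (x + b)" for x
    using periodic_int[where F = F and x = "x + b" and m = m, OF per] by (simp add: b_def)
  note Fa = this
  have A: "F absolutely_integrable_on {-pi..pi}" using F period_integral_iff[of F] by auto
  then have A1: "F absolutely_integrable_on {-pi..-pi+b}" and A2: "F absolutely_integrable_on {-pi+b..pi}"
    using b by (auto elim!: set_integrable_subset)
  have B1: "(\<lambda>x. F (x + b)) absolutely_integrable_on {-pi..pi-b} \<and>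
      integral {-pi..pi-b} (\<lambda>x. F (x + b)) = integral {-pi+b..pi} F"
    using absolutely_integrable_translate[of "-pi" b "pi - b" F] A2 by simp
  have "F (x + b) = F (x + (b - 2 * pi))" for x using per[of "x + (b - 2 * pi)"] by simp
  then have B2: "(\<lambda>x. F (x + b)) absolutely_integrable_on {pi-b..pi} \<and>
      integral {pi-b..pi} (\<lambda>x. F (x + b)) = integral {-pi..-pi+b} F"
    using absolutely_integrable_translate[of "pi - b" "b - 2 * pi" pi F] A1 by (simp add: algebra_simps)
  have "(\<lambda>x. F (x + b)) absolutely_integrable_on {-pi..pi} \<and>
      integral {-pi..pi} (\<lambda>x. F (x + b)) = integral {-pi..pi} F"
    using absolutely_integrable_combine_interval[of "-pi" "pi-b" "\<lambda>x. F (x + b)" pi] B1 B2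
      absolutely_integrable_combine_interval[OF A1 A2] b by auto
  then show ?thesis
    using F period_integral_iff[of F "integral\<^sup>L period_measure F"]
      period_integral_iff[of "\<lambda>x. F (x + b)" "integral\<^sup>L period_measure F"] by (simp add: Fa)
qed

lemma periodic_integral_reflect:
  fixes F :: "real \<Rightarrow> real"
  assumes per: "\<And>x. F (x + 2 * pi) = F x" and F: "integrable period_measure F"
  shows "integrable period_measure (\<lambda>x. F (a - x)) \<and>
    (LINT x|period_measure. F (a - x)) = integral\<^sup>L period_measure F"
proof -
  have A: "(\<lambda>x. F (x + a)) absolutely_integrable_on {-pi..pi} \<and>
      integral {-pi..pi} (\<lambda>x. F (x + a)) = integral\<^sup>L period_measure F"
    using periodic_integral_translate[OF assms, of a]
    unfolding period_integral_iff[of "\<lambda>x. F (x + a)"] .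
  have "(uminus has_field_derivative - 1) (at x within {-pi..pi})" for x :: real
    by (auto intro!: derivative_eq_intros)
  from has_absolute_integral_change_of_variables_1'[of "{-pi..pi}" uminus "\<lambda>_. -1"
      "\<lambda>x. F (x + a)" "integral\<^sup>L period_measure F", OF _ this] A
  show ?thesis unfolding period_integral_iff[of "\<lambda>x. F (a - x)"] by simp
qed

text \<open>The factors are kept general because the Borel line and the completed measure on a
  period both occur as first factor.\<close>

lemma borel_measurable_pair_diff:
  fixes M N :: "real measure"
  assumes "(\<lambda>x. x) \<in> borel_measurable M" "(\<lambda>x. x) \<in> borel_measurable N" "K \<in> borel_measurable borel"
  shows "(\<lambda>p. K (fst p - snd p)) \<in> borel_measurable (M \<Otimes>\<^sub>M N)"
  by (rule measurable_compose[OF borel_measurable_diff assms(3)])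
    (auto intro: measurable_compose[OF measurable_fst] measurable_compose[OF measurable_snd] assms)

text \<open>Borel measurability of \<open>K\<close> passes through the difference map and makes the
  integrand jointly measurable, while \<phi> enters through \<open>t\<close> alone and may be
  Lebesgue measurable.\<close>

lemma convolution_borel_measurable:
  fixes \<phi> K :: "real \<Rightarrow> real"
  assumes [measurable]: "\<phi> \<in> borel_measurable period_measure" and K: "K \<in> borel_measurable borel"
  shows "(\<lambda>x. LINT t|period_measure. \<phi> t * K (x - t)) \<in> borel_measurable borel"
proof -
  have [measurable]: "(\<lambda>p. K (fst p - snd p)) \<in> borel_measurable (borel \<Otimes>\<^sub>M period_measure)"
    by (rule borel_measurable_pair_diff[OF _ _ K]) (auto intro: borel_imp_period_measurable)
  have "(\<lambda>(x, t). \<phi> t * K (x - t)) \<in> borel_measurable (borel \<Otimes>\<^sub>M period_measure)"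
    unfolding case_prod_beta by measurable
  then show ?thesis by (rule period.borel_measurable_lebesgue_integral)
qed

lemma convolution_integrable:
  fixes \<phi> K :: "real \<Rightarrow> real"
  assumes \<phi>: "integrable period_measure \<phi>"
    and K [measurable]: "K \<in> borel_measurable borel" and B: "\<And>x. \<bar>K x\<bar> \<le> B"
  shows "integrable period_measure (\<lambda>t. \<phi> t * K (x - t))"
proof (rule Bochner_Integration.integrable_bound)
  show "integrable period_measure (\<lambda>t. \<phi> t * B)" using \<phi> by simp
  have [measurable]: "(\<lambda>t. K (x - t)) \<in> borel_measurable period_measure"
    by (rule borel_imp_period_measurable) measurable
  show "(\<lambda>t. \<phi> t * K (x - t)) \<in> borel_measurable period_measure"
    using \<phi> by measurable
  have "\<bar>K y\<bar> \<le> \<bar>B\<bar>" for y using B[of y] by linarith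
  then show "AE t in period_measure. norm (\<phi> t * K (x - t)) \<le> norm (\<phi> t * B)"
    by (auto simp: abs_mult intro!: mult_left_mono)
qed

text \<open>The weight \<open>w\<close> is the constant 1 in the bound for \<open>p = 1\<close>, the
  square wave in the duality argument, and a trigonometric polynomial when the mean is computed. A
  multiple of the absolute value of \<phi> dominates the integrand.\<close>

lemma convolution_Fubini:
  fixes \<phi> K :: "real \<Rightarrow> real" and w :: "real \<Rightarrow> 'a::{banach, second_countable_topology}"
  assumes \<phi>: "integrable period_measure \<phi>"
    and K [measurable]: "K \<in> borel_measurable borel" and B: "\<And>x. \<bar>K x\<bar> \<le> B"
    and w [measurable]: "w \<in> borel_measurable borel" and C: "\<And>x. norm (w x) \<le> C"
  shows "(LINT x|period_measure. (LINT t|period_measure. \<phi> t * K (x - t)) *\<^sub>R w x) =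
    (LINT t|period_measure. \<phi> t *\<^sub>R (LINT x|period_measure. K (x - t) *\<^sub>R w x))"
proof -
  have [measurable]: "\<phi> \<in> borel_measurable period_measure" using \<phi> by simp
  define H where "H = (\<lambda>(x, t). (\<phi> t * K (x - t)) *\<^sub>R w x)"
  have B0: "0 \<le> B" using B[of 0] by linarith
  have C0: "0 \<le> C" using C[of 0] norm_ge_zero order.trans by blast
  note \<phi>K = convolution_integrable[OF \<phi> K B]
  have [measurable]: "(\<lambda>p. K (fst p - snd p)) \<in> borel_measurable (period_measure \<Otimes>\<^sub>M period_measure)"
    by (rule borel_measurable_pair_diff[OF _ _ K]) (auto intro: borel_imp_period_measurable)
  have [measurable]: "w \<in> borel_measurable period_measure"
    using w by (rule borel_imp_period_measurable)
  have [measurable]: "H \<in> borel_measurable (period_measure \<Otimes>\<^sub>M period_measure)"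
    unfolding H_def case_prod_beta by measurable
  have Hi: "integrable (period_measure \<Otimes>\<^sub>M period_measure) H"
  proof (rule period_pair.Fubini_integrable)
    show "integrable period_measure (\<lambda>x. LINT t|period_measure. norm (H (x, t)))"
    proof (rule period_integrable_bounded)
      fix x
      have "norm (H (x, t)) \<le> \<bar>\<phi> t\<bar> * (B * C)" for t
        unfolding H_def using B[of "x - t"] C[of x] B0
        by (auto simp: abs_mult mult.assoc intro!: mult_left_mono mult_mono)
      then have "(LINT t|period_measure. norm (H (x, t))) \<le> (LINT t|period_measure. \<bar>\<phi> t\<bar> * (B * C))"
        using \<phi> B0 C0 by (intro integral_mono') auto
      then show "norm (LINT t|period_measure. norm (H (x, t))) \<le> (LINT t|period_measure. \<bar>\<phi> t\<bar> * (B * C))"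
        by simp
    qed measurable
    show "AE x in period_measure. integrable period_measure (\<lambda>t. H (x, t))"
      using \<phi>K by (auto simp: H_def)
  qed measurable
  have "(LINT x|period_measure. (LINT t|period_measure. \<phi> t * K (x - t)) *\<^sub>R w x) =
      (LINT x|period_measure. LINT t|period_measure. H (x, t))"
    using \<phi>K by (simp add: H_def)
  also have "\<dots> = (LINT t|period_measure. LINT x|period_measure. H (x, t))"
    using period_pair.Fubini_integral[of "\<lambda>x t. H (x, t)"] Hi by simp
  also have "\<dots> = (LINT t|period_measure. \<phi> t *\<^sub>R (LINT x|period_measure. K (x - t) *\<^sub>R w x))"
    by (simp add: H_def scaleR_scaleR[symmetric] del: scaleR_scaleR)
  finally show ?thesis .
qed

text \<open>On each half period the integrand is, up to endpoints, plus or minus a sine with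
  antiderivative \<open>F\<close>. The free phase gives the correlation with every translate at
  once.\<close>

lemma square_wave_sin_integral:
  assumes "k \<ge> 1"
  shows "(LINT x|period_measure. sgn (sin x) * sin (real k * x + \<omega>)) = 2 * cos \<omega> * (1 - cos (real k * pi)) / real k"
proof -
  define F where "F x = - cos (real k * x + \<omega>) / real k" for x
  have dF: "(F has_vector_derivative sin (real k * x + \<omega>)) (at x within A)" for x A
    unfolding F_def has_real_derivative_iff_has_vector_derivative[symmetric]
    using assms by (auto intro!: derivative_eq_intros)
  have "((\<lambda>x. sin (real k * x + \<omega>)) has_integral F pi - F 0) {0..pi}"
    by (intro fundamental_theorem_of_calculus dF) auto
  then have 1: "((\<lambda>x. sgn (sin x) * sin (real k * x + \<omega>)) has_integral F pi - F 0) {0..pi}"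
    by (rule has_integral_spike_finite[of "{0, pi}", rotated 2]) (auto simp: sin_gt_zero)
  have "((\<lambda>x. - sin (real k * x + \<omega>)) has_integral - (F 0 - F (-pi))) {-pi..0}"
    by (intro has_integral_neg fundamental_theorem_of_calculus dF) auto
  then have 2: "((\<lambda>x. sgn (sin x) * sin (real k * x + \<omega>)) has_integral - (F 0 - F (-pi))) {-pi..0}"
  proof (rule has_integral_spike_finite[of "{0, -pi}", rotated 2])
    fix x assume "x \<in> {- pi..0} - {0, - pi}"
    then have "sin (-x) > 0" by (intro sin_gt_zero) auto
    then show "sgn (sin x) * sin (real k * x + \<omega>) = - sin (real k * x + \<omega>)" by simp
  qed simp
  have "((\<lambda>x. sgn (sin x) * sin (real k * x + \<omega>)) has_integral - (F 0 - F (-pi)) + (F pi - F 0)) {-pi..pi}"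
    by (rule has_integral_combine[OF _ _ 2 1]) auto
  moreover have "integrable period_measure (\<lambda>x. sgn (sin x) * sin (real k * x + \<omega>))"
    by (rule period_integrable_bounded_borel[of _ 1])
      (measurable, auto simp: abs_mult sgn_if)
  ultimately have "(LINT x|period_measure. sgn (sin x) * sin (real k * x + \<omega>)) = - (F 0 - F (-pi)) + (F pi - F 0)"
    by (simp add: lebesgue_integral_eq_integral integral_unique)
  also have "\<dots> = 2 * cos \<omega> * (1 - cos (real k * pi)) / real k"
    using assms by (simp add: F_def cos_add cos_diff field_simps)
  finally show ?thesis .
qed

lemma square_wave_cos_integral:
  assumes "k \<ge> 1"
  shows "(LINT x|period_measure. sgn (cos x) * cos (real k * x + \<omega>)) =
    2 * cos (\<omega> + pi/2 - real k * pi/2) * (1 - cos (real k * pi)) / real k"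
proof -
  \<comment> \<open>The phase is chosen so that a shift of the sine version by a quarter period,
    \<open>x + pi/2\<close>, produces the cosine version.\<close>
  define w where "w = \<omega> + pi/2 - real k * pi/2"
  define F where "F x = sgn (sin x) * sin (real k * x + w)" for x
  have "integrable period_measure F" unfolding F_def
    by (rule period_integrable_bounded_borel[of _ 1])
      (measurable, auto simp: abs_mult sgn_if)
  moreover have "F (x + 2 * pi) = F x" for x
  proof -
    have "real k * (x + 2 * pi) = real k * x + 2 * pi * of_int (int k)" by (simp add: algebra_simps)
    then show ?thesis by (simp add: F_def sin_add cos_add del: of_int_of_nat_eq)
  qed
  ultimately have "(LINT x|period_measure. F (x + pi/2)) = integral\<^sup>L period_measure F"
    by (intro conjunct2[OF periodic_integral_translate])
  moreover have "F (x + pi/2) = sgn (cos x) * cos (real k * x + \<omega>)" for x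
  proof -
    have "real k * (x + pi/2) + w = (real k * x + \<omega>) + pi/2"
      by (simp add: w_def algebra_simps)
    then show ?thesis unfolding F_def by (simp add: sin_add)
  qed
  ultimately have "(LINT x|period_measure. sgn (cos x) * cos (real k * x + \<omega>)) = integral\<^sup>L period_measure F"
    by simp
  then show ?thesis using square_wave_sin_integral[OF assms, of w] unfolding F_def w_def by simp
qed

section \<open>The norm of a convolution on the unit ball\<close>

lemma antiperiodic_integral_zero:
  fixes F :: "real \<Rightarrow> real"
  assumes "\<And>x. F (x + pi) = - F x" and "integrable period_measure F"
  shows "integral\<^sup>L period_measure F = 0"
proof -
  have "F (x + 2 * pi) = F x" for x using assms(1)[of x] assms(1)[of "x + pi"] by (simp add: algebra_simps)
  from periodic_integral_translate[OF this assms(2), of pi] show ?thesis by (simp add: assms(1))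
qed

lemma Lp_norm_1_eq:
  assumes "integrable period_measure (\<lambda>t. norm (f t))"
  shows "Lp_norm 1 f = ereal (LINT t|period_measure. norm (f t))"
  using nn_integral_eq_integral[OF assms] Bochner_Integration.integral_nonneg[of period_measure "\<lambda>t. norm (f t)"]
  by (simp add: Lp_norm_def Let_def)

text \<open>Since a period has finite measure, functions in either unit ball are integrable; most
  later steps use only this and the vanishing mean.\<close>

lemma H1_D:
  assumes "\<phi> \<in> H1 p" and p: "p = 1 \<or> p = \<infinity>"
  shows H1_periodic: "\<phi> (x + 2 * pi) = \<phi> x"
    and H1_integrable: "integrable period_measure \<phi>"
    and H1_mean: "integral\<^sup>L period_measure \<phi> = 0"
    and H1_norm: "p = 1 \<Longrightarrow> (LINT t|period_measure. \<bar>\<phi> t\<bar>) \<le> 1"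
      "p = \<infinity> \<Longrightarrow> AE t in period_measure. \<bar>\<phi> t\<bar> \<le> 1"
proof -
  note \<phi> = assms(1)[unfolded H1_def Lp_space_def mem_Collect_eq]
  show "\<phi> (x + 2 * pi) = \<phi> x" using \<phi> by blast
  have m [measurable]: "\<phi> \<in> borel_measurable period_measure"
    using \<phi> by (auto intro: measurable_restrict_space1)
  have bd: "AE t in period_measure. \<bar>\<phi> t\<bar> \<le> 1" if "p = \<infinity>"
  proof -
    have "esssup period_measure (\<lambda>t. ereal (norm (\<phi> t))) \<le> 1" using \<phi> that by (auto simp: Lp_norm_def)
    note le = this
    show ?thesis
      using esssup_AE[where M = period_measure and f = "\<lambda>t. ereal (norm (\<phi> t))"]
    proof eventually_elim
      case (elim t)
      from order.trans[OF this le] show ?case by simp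
    qed
  qed
  then show "AE t in period_measure. \<bar>\<phi> t\<bar> \<le> 1" if "p = \<infinity>" using that .
  show I: "integrable period_measure \<phi>"
  proof (cases "p = \<infinity>")
    case True
    with bd show ?thesis by (intro period.integrable_const_bound) auto
  next
    case False
    with p have "p = 1" by simp
    with \<phi> have "Lp_norm 1 \<phi> < \<infinity>" by auto
    then show ?thesis
      by (intro integrableI_bounded) (auto simp: Lp_norm_def Let_def less_top split: if_splits)
  qed
  have "fourier_coeff \<phi> 0 = 0" using \<phi> by auto
  then have "(LINT t|period_measure. complex_of_real (\<phi> t)) = 0"
    by (simp add: fourier_coeff_def)
  then show "integral\<^sup>L period_measure \<phi> = 0" by simp
  show "(LINT t|period_measure. \<bar>\<phi> t\<bar>) \<le> 1" if "p = 1"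
    using \<phi> that I Lp_norm_1_eq[of \<phi>] by auto
qed

lemma H1_I:
  assumes "p = 1 \<or> p = \<infinity>" and per: "\<And>x. \<phi> (x + 2 * pi) = \<phi> x"
    and \<phi>: "\<phi> \<in> borel_measurable borel" and B: "\<And>x. \<bar>\<phi> x\<bar> \<le> B"
    and mean: "integral\<^sup>L period_measure \<phi> = 0"
    and "p = 1 \<Longrightarrow> (LINT t|period_measure. \<bar>\<phi> t\<bar>) \<le> 1" "p = \<infinity> \<Longrightarrow> B \<le> 1"
  shows "\<phi> \<in> H1 p"
proof -
  have [measurable]: "\<phi> \<in> borel_measurable period_measure"
    using \<phi> by (rule borel_imp_period_measurable)
  have I: "integrable period_measure \<phi>" by (rule period_integrable_bounded) (use B in auto)
  have n: "Lp_norm p \<phi> \<le> 1"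
  proof (cases "p = 1")
    case True
    with I assms(6) show ?thesis by (simp add: Lp_norm_1_eq)
  next
    case False
    with assms have *: "p = \<infinity>" "B \<le> 1" by auto
    then have "\<bar>\<phi> x\<bar> \<le> 1" for x using B[of x] by linarith
    then have "esssup period_measure (\<lambda>t. ereal (norm (\<phi> t))) \<le> 1"
      by (intro esssup_I) auto
    then show ?thesis by (simp add: Lp_norm_def *)
  qed
  then have "Lp_norm p \<phi> < \<infinity>" by auto
  moreover have "fourier_coeff \<phi> 0 = 0" by (simp add: fourier_coeff_def mean)
  ultimately show ?thesis using n per \<phi> by (simp add: H1_def Lp_space_def measurable_completion)
qed

text \<open>The essential supremum ignores single points, so continuity is used: a smaller norm
  would leave a threshold \<open>m\<close> exceeded on a whole interval around 0, which has positive
  measure.\<close>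

lemma Lp_norm_infinity_ge:
  fixes g :: "real \<Rightarrow> real"
  assumes "isCont g 0"
  shows "ereal (g 0) \<le> Lp_norm \<infinity> g"
proof (rule ccontr)
  define E where "E = esssup period_measure (\<lambda>t. ereal (norm (g t)))"
  assume "\<not> ereal (g 0) \<le> Lp_norm \<infinity> g"
  then have "E < ereal (g 0)" by (simp add: Lp_norm_def E_def)
  then obtain m where m: "E < ereal m" "m < g 0" using ereal_dense2 by (metis less_ereal.simps(1))
  have "\<forall>\<^sub>F x in at 0. m < g x"
    using assms m by (intro order_tendstoD) (auto simp: isCont_def)
  then obtain d where d: "d > 0" "\<And>x. \<bar>x\<bar> < d \<Longrightarrow> m < g x"
    using m(2) unfolding eventually_at by (auto simp: dist_real_def) (metis)
  define e where "e = min d pi"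
  have e: "0 < e" "e \<le> pi" "e \<le> d" using d by (auto simp: e_def)
  have "AE x in period_measure. x \<notin> {-e<..<e}"
    using esssup_AE[where M = period_measure and f = "\<lambda>t. ereal (norm (g t))"]
  proof eventually_elim
    case (elim x)
    then have "ereal (norm (g x)) < ereal m" using m unfolding E_def by (meson le_less_trans)
    then have "g x < m" by simp
    then show ?case using d(2)[of x] e by (auto simp: abs_less_iff)
  qed
  moreover have "{-e<..<e} \<subseteq> {-pi..pi}" "{x \<in> {-pi..pi}. - e < x \<and> x < e} = {-e<..<e}" using e by auto
  ultimately have "emeasure period_measure {-e<..<e} = 0"
    using AE_iff_measurable[of "{-e<..<e}" period_measure "\<lambda>x. x \<notin> {-e<..<e}"]
    by (simp add: sets_restrict_space_iff)
  then show False using e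
    by (subst (asm) emeasure_restrict_space) (auto simp: emeasure_completion)
qed

text \<open>The supremum is attained by \<open>\<phi> t = \<tau> (- t)\<close> for \<open>p = \<infinity>\<close>; for \<open>p = 1\<close> it is approached by
  functions that concentrate equal positive and negative masses near \<open>0\<close> and \<open>pi\<close>.\<close>

lemma convolution_norm_sup:
  fixes K \<tau> :: "real \<Rightarrow> real" and p :: ereal
  assumes p: "p = 1 \<or> p = \<infinity>"
    and K [measurable]: "K \<in> borel_measurable borel" and K_per: "\<And>x. K (x + 2 * pi) = K x"
    and B: "\<And>x. \<bar>K x\<bar> \<le> B"
    and \<tau> [measurable]: "\<tau> \<in> borel_measurable borel" and \<tau>_le: "\<And>x. \<bar>\<tau> x\<bar> \<le> 1"
    and \<tau>_anti: "\<And>x. \<tau> (x + pi) = - \<tau> x"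
    and sign: "\<And>t. t \<in> {-pi..pi} \<Longrightarrow> \<tau> t * (K t - C) = \<bar>K t - C\<bar>"
    and h: "\<And>y. h y = 1 / (2 * pi) * (LINT x|period_measure. \<tau> x * K (x - y))"
    and h_cont: "isCont h 0"
  shows "(SUP \<phi>\<in>H1 p. Lp_norm p (\<lambda>x. 1 / (2 * pi) * (LINT t|period_measure. \<phi> t * K (x - t)))) = ereal (h 0)"
proof (rule antisym)
  have \<tau>_per: "\<tau> (x + 2 * pi) = \<tau> x" for x
    using \<tau>_anti[of x] \<tau>_anti[of "x + pi"] by (simp add: algebra_simps)
  have \<tau>_int: "integrable period_measure \<tau>" by (rule period_integrable_bounded_borel) (use \<tau>_le in auto)
  have \<tau>_mean: "integral\<^sup>L period_measure \<tau> = 0" by (intro antiperiodic_integral_zero \<tau>_anti \<tau>_int)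
  have B0: "0 \<le> B" using B[of 0] by linarith
  have K_per': "K (x + 2 * pi - y) = K (x - y)" for x y
    using K_per[of "x - y"] by (simp add: algebra_simps)
  have \<tau>K_le: "\<bar>\<tau> x * K y\<bar> \<le> B" for x y
    using mult_mono[of "\<bar>\<tau> x\<bar>" 1 "\<bar>K y\<bar>" B] \<tau>_le[of x] B[of y] by (simp add: abs_mult)
  have \<tau>K_int: "integrable period_measure (\<lambda>x. \<tau> x * K (x - y))" for y
    by (rule period_integrable_bounded_borel[of _ B]) (use \<tau>K_le in auto)
  have KC_le: "\<bar>\<bar>K x - C\<bar>\<bar> \<le> B + \<bar>C\<bar>" for x using B[of x] by simp
  have KC_int: "integrable period_measure (\<lambda>x. \<bar>K x - C\<bar>)"
    by (rule period_integrable_bounded_borel[of _ "B + \<bar>C\<bar>"]) (use KC_le in auto)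
  have KC_refl: "integrable period_measure (\<lambda>t. \<bar>K (x - t) - C\<bar>)"
      "(LINT t|period_measure. \<bar>K (x - t) - C\<bar>) = (LINT t|period_measure. \<bar>K t - C\<bar>)" for x
    using periodic_integral_reflect[OF _ KC_int, of x] by (auto simp: K_per)
  have KC_trans: "(LINT x|period_measure. \<bar>K (x - t) - C\<bar>) = (LINT x|period_measure. \<bar>K x - C\<bar>)" for t
    using periodic_integral_translate[OF _ KC_int, of "-t"] by (auto simp: K_per)
  \<comment> \<open>As \<tau> has mean zero, the constant \<open>C\<close> can be subtracted from
    \<open>K\<close>, and then \<tau> acts as the sign of \<open>K - C\<close>.\<close>
  have h0: "2 * pi * h 0 = (LINT t|period_measure. \<bar>K t - C\<bar>)"
  proof -
    have "2 * pi * h 0 = (LINT x|period_measure. \<tau> x * K x)" by (simp add: h)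
    also have "\<dots> = (LINT x|period_measure. \<tau> x * K x - C * \<tau> x)"
      using \<tau>K_int[of 0] \<tau>_int \<tau>_mean by simp
    also have "\<dots> = (LINT t|period_measure. \<bar>K t - C\<bar>)"
      by (intro Bochner_Integration.integral_cong) (auto simp: sign[symmetric] algebra_simps)
    finally show ?thesis .
  qed
  \<comment> \<open>\<open>h\<close> inherits antiperiodicity from \<tau>; this makes the negative
    mass near \<open>pi\<close> contribute as much as the positive mass near 0.\<close>
  have h_anti: "h (y + pi) = - h y" for y
  proof -
    have "(LINT x|period_measure. \<tau> (x + pi) * K (x + pi - (y + pi))) = (LINT x|period_measure. \<tau> x * K (x - (y + pi)))"
      by (intro conjunct2[OF periodic_integral_translate[OF _ \<tau>K_int]]) (simp only: \<tau>_per K_per')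
    then have "(LINT x|period_measure. \<tau> x * K (x - (y + pi))) = - (LINT x|period_measure. \<tau> x * K (x - y))"
      by (simp add: \<tau>_anti)
    then show ?thesis unfolding h by simp
  qed

  show "(SUP \<phi>\<in>H1 p. Lp_norm p (\<lambda>x. 1 / (2 * pi) * (LINT t|period_measure. \<phi> t * K (x - t)))) \<le> ereal (h 0)"
  proof (rule SUP_least)
    fix \<phi> assume \<phi>: "\<phi> \<in> H1 p"
    note \<phi>_int = H1_integrable[OF \<phi> p]
    then have [measurable]: "\<phi> \<in> borel_measurable period_measure" by simp
    note \<phi>K_int = convolution_integrable[OF \<phi>_int K B]
    define g where "g x = 1 / (2 * pi) * (LINT t|period_measure. \<phi> t * K (x - t))" for x
    have g_borel: "g \<in> borel_measurable borel"
      unfolding g_def using convolution_borel_measurable[OF _ K, of \<phi>] by measurable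
    then have [measurable]: "g \<in> borel_measurable period_measure"
      by (rule borel_imp_period_measurable)
    \<comment> \<open>The mean of \<phi> vanishes, so again \<open>K\<close> may be replaced by
      \<open>K - C\<close>.\<close>
    have g_le: "2 * pi * \<bar>g x\<bar> \<le> (LINT t|period_measure. \<bar>\<phi> t\<bar> * \<bar>K (x - t) - C\<bar>)" for x
    proof -
      have "2 * pi * g x = (LINT t|period_measure. \<phi> t * K (x - t) - C * \<phi> t)"
        using \<phi>K_int[of x] \<phi>_int H1_mean[OF \<phi> p] by (simp add: g_def)
      also have "\<dots> = (LINT t|period_measure. \<phi> t * (K (x - t) - C))"
        by (simp add: algebra_simps)
      finally have "2 * pi * \<bar>g x\<bar> = \<bar>LINT t|period_measure. \<phi> t * (K (x - t) - C)\<bar>"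
        by (metis abs_mult abs_of_pos pi_gt_zero zero_less_mult_iff zero_less_numeral)
      also have "\<dots> \<le> (LINT t|period_measure. \<bar>\<phi> t * (K (x - t) - C)\<bar>)"
        by (rule integral_abs_bound)
      finally show ?thesis by (simp add: abs_mult)
    qed
    show "Lp_norm p (\<lambda>x. 1 / (2 * pi) * (LINT t|period_measure. \<phi> t * K (x - t))) \<le> ereal (h 0)"
      unfolding g_def[symmetric]
    proof (cases "p = \<infinity>")
      case True
      have "\<bar>g x\<bar> \<le> h 0" for x
      proof -
        have "(LINT t|period_measure. \<bar>\<phi> t\<bar> * \<bar>K (x - t) - C\<bar>) \<le> (LINT t|period_measure. \<bar>K (x - t) - C\<bar>)"
        proof (rule integral_mono_AE')
          show "AE t in period_measure. \<bar>\<phi> t\<bar> * \<bar>K (x - t) - C\<bar> \<le> \<bar>K (x - t) - C\<bar>"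
            using H1_norm(2)[OF \<phi> p True] by eventually_elim (simp add: mult_left_le_one_le)
        qed (use KC_refl in auto)
        with g_le[of x] have "2 * pi * \<bar>g x\<bar> \<le> 2 * pi * h 0" by (simp add: KC_refl h0)
        then show ?thesis by simp
      qed
      then have "esssup period_measure (\<lambda>t. ereal (norm (g t))) \<le> h 0" by (intro esssup_I) auto
      then show "Lp_norm p g \<le> ereal (h 0)" by (simp add: Lp_norm_def True)
    next
      case False
      with p have p1: "p = 1" by simp
      let ?KC = "\<lambda>x. \<bar>K x - C\<bar>"
      have "norm (g x) \<le> (LINT t|period_measure. \<bar>\<phi> t\<bar> * (B + \<bar>C\<bar>)) / (2 * pi)" for x
      proof -
        have "(LINT t|period_measure. \<bar>\<phi> t\<bar> * ?KC (x - t)) \<le> (LINT t|period_measure. \<bar>\<phi> t\<bar> * (B + \<bar>C\<bar>))"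
          by (rule integral_mono') (use \<phi>_int KC_le B0 in \<open>auto intro!: mult_left_mono\<close>)
        with g_le[of x] show ?thesis by (simp add: field_simps)
      qed
      then have g_int: "integrable period_measure g"
        by (intro period_integrable_bounded_borel g_borel)
      \<comment> \<open>Young's inequality for \<open>p = 1\<close>: after exchanging the integrals,
        the inner one is the same for all translates.\<close>
      have "(LINT x|period_measure. 2 * pi * \<bar>g x\<bar>) \<le>
          (LINT x|period_measure. (LINT t|period_measure. \<bar>\<phi> t\<bar> * ?KC (x - t)))"
      proof (rule integral_mono)
        show "integrable period_measure (\<lambda>x. LINT t|period_measure. \<bar>\<phi> t\<bar> * ?KC (x - t))"
        proof (rule period_integrable_bounded_borel)
          show "(\<lambda>x. LINT t|period_measure. \<bar>\<phi> t\<bar> * ?KC (x - t)) \<in> borel_measurable borel"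
            by (intro convolution_borel_measurable) measurable
          fix x
          have "(LINT t|period_measure. \<bar>\<phi> t\<bar> * ?KC (x - t)) \<le> (LINT t|period_measure. \<bar>\<phi> t\<bar> * (B + \<bar>C\<bar>))"
            by (rule integral_mono') (use \<phi>_int KC_le B0 in \<open>auto intro!: mult_left_mono\<close>)
          then show "norm (LINT t|period_measure. \<bar>\<phi> t\<bar> * ?KC (x - t)) \<le> (LINT t|period_measure. \<bar>\<phi> t\<bar> * (B + \<bar>C\<bar>))"
            by simp
        qed
      qed (use g_int g_le in auto)
      also have "\<dots> = (LINT t|period_measure. \<bar>\<phi> t\<bar> * (LINT x|period_measure. ?KC (x - t)))"
        using convolution_Fubini[of "\<lambda>t. \<bar>\<phi> t\<bar>" ?KC "B + \<bar>C\<bar>" "\<lambda>_. 1::real" 1] \<phi>_int KC_le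
        by simp
      also have "\<dots> = (LINT t|period_measure. \<bar>\<phi> t\<bar>) * (2 * pi * h 0)"
        by (simp add: KC_trans h0)
      also have "\<dots> \<le> 2 * pi * h 0"
        using H1_norm(1)[OF \<phi> p p1] by (intro mult_left_le_one_le) (auto simp: h0)
      finally have "(LINT x|period_measure. \<bar>g x\<bar>) \<le> h 0" by simp
      then show "Lp_norm p g \<le> ereal (h 0)" using g_int by (simp add: p1 Lp_norm_1_eq)
    qed
  qed

  show "ereal (h 0) \<le> (SUP \<phi>\<in>H1 p. Lp_norm p (\<lambda>x. 1 / (2 * pi) * (LINT t|period_measure. \<phi> t * K (x - t))))"
  proof (cases "p = \<infinity>")
    case True
    define \<phi> where "\<phi> = (\<lambda>t. \<tau> (- t))"
    have "integral\<^sup>L period_measure \<phi> = 0"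
      using periodic_integral_reflect[OF \<tau>_per \<tau>_int, of 0] by (simp add: \<phi>_def \<tau>_mean)
    moreover have "\<phi> (x + 2 * pi) = \<phi> x" for x
      using \<tau>_per[of "- x - 2 * pi"] by (simp add: \<phi>_def)
    moreover have "\<phi> \<in> borel_measurable borel" unfolding \<phi>_def by measurable
    ultimately have \<phi>: "\<phi> \<in> H1 p"
      using True \<tau>_le by (intro H1_I[of p \<phi> 1] p) (auto simp: \<phi>_def)
    have "1 / (2 * pi) * (LINT t|period_measure. \<phi> t * K (x - t)) = h (- x)" for x
    proof -
      have "(LINT t|period_measure. \<tau> (0 - t) * K (0 - t - (- x))) = (LINT t|period_measure. \<tau> t * K (t - (- x)))"
        by (intro conjunct2[OF periodic_integral_reflect[OF _ \<tau>K_int]]) (simp only: \<tau>_per K_per')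
      then show ?thesis by (simp add: \<phi>_def h)
    qed
    \<comment> \<open>The convolution takes the value \<open>h 0\<close> at the point 0; continuity
      carries it over to the essential supremum.\<close>
    moreover have "isCont (\<lambda>x. h (- x)) 0"
      using h_cont by (intro isCont_o2[of 0 uminus h]) auto
    ultimately have "ereal (h 0) \<le> Lp_norm p (\<lambda>x. 1 / (2 * pi) * (LINT t|period_measure. \<phi> t * K (x - t)))"
      using Lp_norm_infinity_ge[of "\<lambda>x. h (- x)"] True by simp
    then show ?thesis by (intro SUP_upper2[OF \<phi>])
  next
    case False
    with p have p1: "p = 1" by simp
    show ?thesis
    proof (rule dense_le)
      \<comment> \<open>Attainment is not claimed for \<open>p = 1\<close>: every number below
        \<open>h 0\<close> is shown to be at most the supremum.\<close>
      fix m' assume m': "m' < ereal (h 0)"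
      show "m' \<le> (SUP \<phi>\<in>H1 p. Lp_norm p (\<lambda>x. 1 / (2 * pi) * (LINT t|period_measure. \<phi> t * K (x - t))))"
      proof (cases m')
        case (real m)
        with m' have "m < h 0" by simp
        then have "\<forall>\<^sub>F x in at 0. m < h x"
          using h_cont by (intro order_tendstoD) (auto simp: isCont_def)
        then obtain d0 where d0: "d0 > 0" "\<And>x. \<bar>x\<bar> < d0 \<Longrightarrow> m < h x"
          using \<open>m < h 0\<close> unfolding eventually_at by (auto simp: dist_real_def) (metis)
        \<comment> \<open>The cap 1 keeps \<open>d\<close> below \<open>pi/2\<close>, where the sine
          increases, so that \<open>\<bar>sin y\<bar> < sin d\<close> describes short arcs around 0
          and \<open>pi\<close>.\<close>
        define d where "d = min d0 1"
        have d: "0 < d" "d < pi/2" "d \<le> d0" using d0 pi_half_gt_zero pi_gt3 by (auto simp: d_def)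
        have near: "\<bar>y\<bar> < d" if "y \<in> {-pi..pi}" "cos y > 0" "\<bar>sin y\<bar> < sin d" for y
        proof (rule ccontr)
          assume "\<not> \<bar>y\<bar> < d"
          have "cos \<bar>y\<bar> > 0" using that by (simp add: abs_if)
          then have "\<bar>y\<bar> \<le> pi/2"
            using that cos_monotone_0_pi_le[of "pi/2" "\<bar>y\<bar>"] by (auto simp: abs_le_iff) (smt (verit) cos_pi_half)
          then have "sin d \<le> sin \<bar>y\<bar>" using \<open>\<not> \<bar>y\<bar> < d\<close> d by (intro sin_monotone_2pi_le) auto
          with that show False by (auto simp: abs_if split: if_splits)
        qed
        \<comment> \<open>The value is 1 near 0, -1 near \<open>pi\<close> and \<open>- pi\<close>,
          and 0 elsewhere. Writing it with sine and cosine makes periodicity, antiperiodicity and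
          measurability immediate.\<close>
        define \<xi> where "\<xi> y = sgn (cos y) * indicat_real {y. \<bar>sin y\<bar> < sin d} y" for y
        have [measurable]: "\<xi> \<in> borel_measurable borel" unfolding \<xi>_def by measurable
        have \<xi>_le: "\<bar>\<xi> y\<bar> \<le> 1" for y by (auto simp: \<xi>_def indicator_def sgn_if)
        have \<xi>_anti: "\<xi> (y + pi) = - \<xi> y" for y by (auto simp: \<xi>_def indicator_def)
        have \<xi>_per: "\<xi> (y + 2 * pi) = \<xi> y" for y by (auto simp: \<xi>_def indicator_def)
        have \<xi>_int: "integrable period_measure \<xi>"
          by (rule period_integrable_bounded_borel) (use \<xi>_le in auto)
        have \<xi>h: "m * \<bar>\<xi> y\<bar> \<le> \<xi> y * h y" if y: "y \<in> {-pi..pi}" for y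
        proof (cases "\<bar>sin y\<bar> < sin d \<and> cos y \<noteq> 0")
          case inside: True
          show ?thesis
          proof (cases "cos y > 0")
            case True
            with inside near[OF y] d0(2)[of y] d show ?thesis by (simp add: \<xi>_def)
          next
            case False
            \<comment> \<open>A point near \<open>pi\<close> or \<open>- pi\<close> is moved by half
              a period to a point near 0, where \<open>h\<close> exceeds \<open>m\<close>.\<close>
            define z where "z = (if y > 0 then y - pi else y + pi)"
            have "z \<in> {-pi..pi}" "cos z > 0" "\<bar>sin z\<bar> < sin d"
              using y False inside by (auto simp: z_def cos_diff sin_diff)
            then have "m < h z" using near[of z] d0(2)[of z] d by auto
            moreover have "h z = - h y" using h_anti[of y] h_anti[of "y - pi"] by (auto simp: z_def)
            ultimately show ?thesis using False inside by (simp add: \<xi>_def)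
          qed
        qed (auto simp: \<xi>_def indicator_def)
        define \<kappa> where "\<kappa> = (LINT t|period_measure. \<bar>\<xi> t\<bar>)"
        have "(LINT t|period_measure. indicat_real {-d<..<d} t) \<le> \<kappa>"
          unfolding \<kappa>_def
        proof (rule integral_mono)
          show "integrable period_measure (indicat_real {-d<..<d})"
            by (rule period_integrable_bounded_borel[of _ 1]) auto
          fix t
          show "indicat_real {-d<..<d} t \<le> \<bar>\<xi> t\<bar>"
          proof (cases "t \<in> {-d<..<d}")
            case True
            then have "cos t > 0" "sin t < sin d" using d
              by (auto intro!: cos_gt_zero_pi sin_monotone_2pi)
            moreover have "sin (- t) < sin d" using d True by (intro sin_monotone_2pi) auto
            ultimately show ?thesis by (auto simp: \<xi>_def indicator_def)
          qed simp
        qed (use \<xi>_int in auto)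
        moreover have "(LINT t|period_measure. indicat_real {-d<..<d} t) = 2 * d"
        proof -
          have "{-d<..<d} \<inter> {-pi..pi} = {-d<..<d}" "{-d<..<d} \<subseteq> {-pi..pi}" using d by auto
          then show ?thesis using d by (simp add: measure_restrict_space)
        qed
        ultimately have \<kappa>: "\<kappa> > 0" using d by simp
        define \<phi> where "\<phi> = (\<lambda>t. \<xi> t / \<kappa>)"
        have [measurable]: "\<phi> \<in> borel_measurable borel" unfolding \<phi>_def by measurable
        have \<phi>_int: "integrable period_measure \<phi>" unfolding \<phi>_def using \<xi>_int by simp
        have \<phi>_norm: "(LINT t|period_measure. \<bar>\<phi> t\<bar>) = 1"
          using \<kappa> by (simp add: \<phi>_def \<kappa>_def)
        have \<phi>: "\<phi> \<in> H1 p"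
        proof (rule H1_I[OF p, of _ "1 / \<kappa>"])
          show "integral\<^sup>L period_measure \<phi> = 0"
            by (rule antiperiodic_integral_zero[OF _ \<phi>_int]) (simp add: \<phi>_def \<xi>_anti)
        qed (use \<kappa> \<xi>_le \<phi>_norm p1 in \<open>auto simp: \<phi>_def \<xi>_per divide_right_mono\<close>)
        define g where "g x = 1 / (2 * pi) * (LINT t|period_measure. \<phi> t * K (x - t))" for x
        have g_borel: "g \<in> borel_measurable borel"
          unfolding g_def using convolution_borel_measurable[OF _ K, of \<phi>] \<phi>_int by measurable
        have "\<bar>LINT t|period_measure. \<phi> t * K (x - t)\<bar> \<le> B" for x
        proof -
          have "\<bar>LINT t|period_measure. \<phi> t * K (x - t)\<bar> \<le> (LINT t|period_measure. \<bar>\<phi> t * K (x - t)\<bar>)"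
            by (rule integral_abs_bound)
          also have "\<dots> \<le> (LINT t|period_measure. \<bar>\<phi> t\<bar> * B)"
            by (rule integral_mono') (use \<phi>_int B B0 in \<open>auto simp: abs_mult intro!: mult_left_mono\<close>)
          finally show ?thesis by (simp add: \<phi>_norm)
        qed
        then have g_le: "\<bar>g x\<bar> \<le> B / (2 * pi)" for x
          by (simp add: g_def abs_mult divide_right_mono)
        have g_int: "integrable period_measure g"
          by (rule period_integrable_bounded_borel) (use g_le g_borel in auto)
        \<comment> \<open>Written as a convolution of \<tau> with the reflected kernel,
          \<open>h\<close> is covered by the measurability lemma.\<close>
        have h_eq: "h = (\<lambda>y. 1 / (2 * pi) * (LINT x|period_measure. \<tau> x * K (- (y - x))))"
          by (simp add: h fun_eq_iff)
        have h_borel: "h \<in> borel_measurable borel"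
          unfolding h_eq using convolution_borel_measurable[of \<tau> "\<lambda>s. K (- s)"] \<tau>_int by measurable
        have "\<bar>h y\<bar> \<le> 1 / (2 * pi) * (LINT x|period_measure. B)" for y
        proof -
          have "\<bar>LINT x|period_measure. \<tau> x * K (x - y)\<bar> \<le> (LINT x|period_measure. \<bar>\<tau> x * K (x - y)\<bar>)"
            by (rule integral_abs_bound)
          also have "\<dots> \<le> (LINT x|period_measure. B)"
            by (rule integral_mono) (use \<tau>K_int \<tau>K_le in auto)
          finally show ?thesis by (simp add: h abs_mult divide_right_mono)
        qed
        note h_le = this
        \<comment> \<open>Duality: \<phi> lives where \<open>h\<close> exceeds \<open>m\<close> up
          to the sign of \<phi>, so pairing it with \<open>h\<close> gives at least
          \<open>m\<close>. Fubini turns this into the pairing of \<open>g\<close> with \<tau>,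
          which is bounded by 1.\<close>
        have "m = (LINT t|period_measure. m * \<bar>\<phi> t\<bar>)" by (simp add: \<phi>_norm)
        also have "\<dots> \<le> (LINT t|period_measure. \<phi> t * h t)"
        proof (rule integral_mono)
          show "integrable period_measure (\<lambda>t. \<phi> t * h t)"
            using convolution_integrable[OF \<phi>_int, of "\<lambda>s. h (- s)" "1 / (2 * pi) * (LINT x|period_measure. B)" 0] h_borel h_le by simp
          show "m * \<bar>\<phi> t\<bar> \<le> \<phi> t * h t" if "t \<in> space period_measure" for t
            using \<xi>h[of t] that \<kappa> by (simp add: \<phi>_def divide_right_mono)
        qed (use \<phi>_int in auto)
        also have "\<dots> = 1 / (2 * pi) * (LINT t|period_measure. \<phi> t * (LINT x|period_measure. K (x - t) * \<tau> x))"
          by (simp add: h mult_ac)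
        also have "\<dots> = 1 / (2 * pi) * (LINT x|period_measure. (LINT t|period_measure. \<phi> t * K (x - t)) * \<tau> x)"
          using convolution_Fubini[OF \<phi>_int K B \<tau>, of 1] \<tau>_le by simp
        also have "\<dots> = (LINT x|period_measure. g x * \<tau> x)" by (simp add: g_def mult_ac)
        also have "\<dots> \<le> (LINT x|period_measure. \<bar>g x\<bar>)"
        proof (rule integral_mono)
          show *: "g x * \<tau> x \<le> \<bar>g x\<bar>" for x
            using mult_left_mono[OF \<tau>_le[of x], of "\<bar>g x\<bar>"] abs_ge_self[of "g x * \<tau> x"] by (simp add: abs_mult)
          show "integrable period_measure (\<lambda>x. g x * \<tau> x)"
            using g_int \<tau>_int \<tau>_le
            by (intro Bochner_Integration.integrable_bound[OF g_int]) (auto simp: abs_mult intro!: mult_left_le)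
        qed (use g_int in auto)
        finally have "m' \<le> Lp_norm p g" using g_int by (simp add: real p1 Lp_norm_1_eq)
        then show ?thesis unfolding g_def by (intro SUP_upper2[OF \<phi>])
      qed (use m' in auto)
    qed
  qed
qed

section \<open>The deviation as a convolution\<close>

text \<open>A shift by the half wavelength \<open>pi / m\<close> preserves the integral and reverses
  its sign.\<close>

lemma integral_cos_int:
  assumes "m \<noteq> (0::int)"
  shows "(LINT t|period_measure. cos (of_int m * t + \<omega>)) = 0"
proof -
  have I: "integrable period_measure (\<lambda>t. cos (of_int m * t + \<omega>))"
    by (rule period_integrable_bounded_borel[of _ 1]) auto
  have "cos (of_int m * (x + 2 * pi) + \<omega>) = cos (of_int m * x + \<omega>)" for x
  proof -
    have "of_int m * (x + 2 * pi) + \<omega> = (of_int m * x + \<omega>) + 2 * pi * of_int m" by (simp add: algebra_simps)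
    moreover have "cos (z + 2 * pi * of_int m) = cos z" for z by (simp add: cos_add)
    ultimately show ?thesis by (simp only:)
  qed
  from periodic_integral_translate[OF this I, of "pi / of_int m"]
  have "(LINT t|period_measure. cos (of_int m * t + \<omega>)) = (LINT t|period_measure. cos (of_int m * (t + pi / of_int m) + \<omega>))"
    by simp
  also have "(\<lambda>t. cos (of_int m * (t + pi / of_int m) + \<omega>)) = (\<lambda>t. - cos (of_int m * t + \<omega>))"
  proof
    fix t
    have "of_int m * (t + pi / of_int m) + \<omega> = (of_int m * t + \<omega>) + pi"
      using assms by (simp add: algebra_simps)
    then show "cos (of_int m * (t + pi / of_int m) + \<omega>) = - cos (of_int m * t + \<omega>)"
      by (simp only: cos_periodic_pi)
  qed
  finally show ?thesis by simp
qed

text \<open>Orthogonality with a phase. The sum frequency \<open>j + k\<close> is nonzero because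
  \<open>j \<ge> 1\<close>; the difference frequency vanishes exactly for
  \<open>j = k\<close>.\<close>

lemma integral_cos_cos:
  fixes j k :: nat
  assumes "j \<ge> 1"
  shows "(LINT y|period_measure. 2 * cos (real j * (y - t) - \<theta>) * cos (real k * (x - y))) =
    (if j = k then 2 * pi * cos (real k * (x - t) - \<theta>) else 0)"
proof -
  define \<omega>1 where "\<omega>1 = real k * x - real j * t - \<theta>"
  define \<omega>2 where "\<omega>2 = - real k * x - real j * t - \<theta>"
  have "2 * cos (real j * (y - t) - \<theta>) * cos (real k * (x - y)) =
      cos (of_int (int j - int k) * y + \<omega>1) + cos (of_int (int j + int k) * y + \<omega>2)" for y
  proof -
    have "cos (of_int (int j - int k) * y + \<omega>1) = cos ((real j * (y - t) - \<theta>) + real k * (x - y))"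
      "cos (of_int (int j + int k) * y + \<omega>2) = cos ((real j * (y - t) - \<theta>) - real k * (x - y))"
      by (simp_all add: \<omega>1_def \<omega>2_def algebra_simps)
    then show ?thesis by (simp only: cos_add cos_diff)
  qed
  moreover have "integrable period_measure (\<lambda>y. cos (of_int m * y + w))" for m :: int and w
    by (rule period_integrable_bounded_borel[of _ 1]) auto
  ultimately have "(LINT y|period_measure. 2 * cos (real j * (y - t) - \<theta>) * cos (real k * (x - y))) =
    (LINT y|period_measure. cos (of_int (int j - int k) * y + \<omega>1)) + (LINT y|period_measure. cos (of_int (int j + int k) * y + \<omega>2))"
    by (simp del: of_int_diff of_int_add)
  also have "(LINT y|period_measure. cos (of_int (int j + int k) * y + \<omega>2)) = 0"
    using assms by (intro integral_cos_int) simp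
  also have "(LINT y|period_measure. cos (of_int (int j - int k) * y + \<omega>1)) =
      (if j = k then 2 * pi * cos (real k * (x - t) - \<theta>) else 0)"
  proof (cases "j = k")
    case True
    then show ?thesis by (simp add: \<omega>1_def measure_restrict_space algebra_simps)
  next
    case False
    then show ?thesis using integral_cos_int[of "int j - int k" \<omega>1] by simp
  qed
  finally show ?thesis by simp
qed

lemma symmetric_exp_sum:
  fixes c :: "nat \<Rightarrow> real"
  shows "(\<Sum>k\<in>{- int n..int n}. complex_of_real (c (nat \<bar>k\<bar>)) * exp (\<i> * of_int k * of_real s)) =
    complex_of_real (c 0 + (\<Sum>k=1..n. c k * (2 * cos (real k * s))))"
proof (induction n)
  case (Suc n)
  have "{- int (Suc n)..int (Suc n)} = insert (int (Suc n)) (insert (- int (Suc n)) {- int n..int n})"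
    by auto
  then have "(\<Sum>k\<in>{- int (Suc n)..int (Suc n)}. complex_of_real (c (nat \<bar>k\<bar>)) * exp (\<i> * of_int k * of_real s)) =
    complex_of_real (c (Suc n)) * (exp (\<i> * of_real (real (Suc n) * s)) + exp (- (\<i> * of_real (real (Suc n) * s)))) +
    (\<Sum>k\<in>{- int n..int n}. complex_of_real (c (nat \<bar>k\<bar>)) * exp (\<i> * of_int k * of_real s))"
    by (simp add: algebra_simps nat_add_distrib)
  also have "exp (\<i> * of_real (real (Suc n) * s)) + exp (- (\<i> * of_real (real (Suc n) * s))) =
      complex_of_real (2 * cos (real (Suc n) * s))"
    by (simp add: cos_of_real[symmetric] cos_exp_eq del: of_nat_Suc)
  finally show ?case unfolding Suc by (simp add: algebra_simps)
qed simp

text \<open>The mean is convolution with a real trigonometric polynomial: the sum is cut to indices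
  between \<open>- N\<close> and \<open>N\<close>, moved under the integral, and conjugate
  exponentials are paired.\<close>

lemma multiplier_mean_eq:
  fixes c :: "nat \<Rightarrow> real" and f :: "real \<Rightarrow> real"
  assumes f: "integrable period_measure f" and c: "\<And>k. k \<ge> N \<Longrightarrow> c k = 0"
  shows "(\<Sum>\<^sub>\<infinity>k::int. complex_of_real (c (nat \<bar>k\<bar>)) * fourier_coeff f k * exp (\<i> * k * x)) =
    complex_of_real (1 / (2 * pi) * (LINT t|period_measure. f t * (c 0 + (\<Sum>k=1..N. c k * (2 * cos (real k * (x - t)))))))"
proof -
  have int: "integrable period_measure (\<lambda>t. complex_of_real (f t) * exp (\<i> * of_int k * of_real (x - t)))" for k :: int
  proof (rule Bochner_Integration.integrable_bound)
    show "integrable period_measure (\<lambda>t. complex_of_real (f t))" using f by simp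
    have "(\<lambda>t. exp (\<i> * of_int k * of_real (x - t))) \<in> borel_measurable borel"
      by (intro borel_measurable_continuous_onI continuous_intros)
    then show "(\<lambda>t. complex_of_real (f t) * exp (\<i> * of_int k * of_real (x - t))) \<in> borel_measurable period_measure"
      using f by (intro borel_measurable_times) (auto intro: borel_imp_period_measurable)
    show "AE t in period_measure. norm (complex_of_real (f t) * exp (\<i> * of_int k * of_real (x - t))) \<le> norm (complex_of_real (f t))"
      by (simp add: norm_mult)
  qed
  have coeff: "fourier_coeff f k * exp (\<i> * k * x) =
    1 / (2 * pi) * (LINT t|period_measure. complex_of_real (f t) * exp (\<i> * of_int k * of_real (x - t)))" for k :: int
  proof -
    have "exp (\<i> * of_int k * of_real (x - t)) = exp (- \<i> * k * t) * exp (\<i> * k * x)" for t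
      by (simp add: exp_add[symmetric] algebra_simps)
    then show ?thesis
      by (simp add: fourier_coeff_def mult.assoc[symmetric] del: mult_minus_left of_real_diff)
  qed
  have "(\<Sum>\<^sub>\<infinity>k::int. complex_of_real (c (nat \<bar>k\<bar>)) * fourier_coeff f k * exp (\<i> * k * x)) =
    (\<Sum>\<^sub>\<infinity>k\<in>{- int N..int N}. complex_of_real (c (nat \<bar>k\<bar>)) * fourier_coeff f k * exp (\<i> * k * x))"
    by (rule infsum_cong_neutral) (auto simp: c)
  also have "\<dots> = (\<Sum>k\<in>{- int N..int N}. complex_of_real (c (nat \<bar>k\<bar>)) * (fourier_coeff f k * exp (\<i> * k * x)))"
    by (simp add: mult.assoc)
  also have "\<dots> = 1 / (2 * pi) * (\<Sum>k\<in>{- int N..int N}. LINT t|period_measure.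
      complex_of_real (c (nat \<bar>k\<bar>)) * (complex_of_real (f t) * exp (\<i> * of_int k * of_real (x - t))))"
    unfolding coeff sum_distrib_left
    by (intro sum.cong refl, subst integral_mult_right_zero) (rule mult.left_commute)
  also have "\<dots> = 1 / (2 * pi) * (LINT t|period_measure. (\<Sum>k\<in>{- int N..int N}.
      complex_of_real (c (nat \<bar>k\<bar>)) * (complex_of_real (f t) * exp (\<i> * of_int k * of_real (x - t)))))"
    using int by (subst Bochner_Integration.integral_sum) (auto simp del: of_real_diff)
  also have "(\<lambda>t. \<Sum>k\<in>{- int N..int N}. complex_of_real (c (nat \<bar>k\<bar>)) * (complex_of_real (f t) * exp (\<i> * of_int k * of_real (x - t)))) =
      (\<lambda>t. complex_of_real (f t * (c 0 + (\<Sum>k=1..N. c k * (2 * cos (real k * (x - t)))))))"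
    unfolding of_real_mult symmetric_exp_sum[symmetric] sum_distrib_left
    by (intro ext sum.cong refl) (simp add: mult_ac)
  finally show ?thesis by (simp only: integral_complex_of_real) simp
qed

context
  fixes r \<beta> :: real
  assumes r: "r = 1 \<and> cos (\<beta> * pi / 2) = 0 \<or> r \<ge> 2"
begin

lemma psi_partial_sums_tendsto: "(\<lambda>n. \<Sum>k=1..n. 2 * cos (real k * t - \<beta> * pi / 2) / real k powr r) \<longlonglongrightarrow> psi r \<beta> t"
proof -
  have "(\<Sum>k=1..n. 2 * cos (real k * t - \<beta> * pi / 2) / real k powr r) =
     (\<Sum>k<n. 2 * cos (real (Suc k) * t - \<beta> * pi / 2) / real (Suc k) powr r)" for n
    by (simp add: sum.atLeast1_atMost_eq)
  with trig_series_bounded_convergent(2)[OF r, of t] show ?thesis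
    by (simp add: psi_def summable_iff_convergent[symmetric] summable_LIMSEQ)
qed

lemma psi_periodic: "psi r \<beta> (x + 2 * pi) = psi r \<beta> x"
proof -
  have "cos (real k * (x + 2 * pi) - \<beta> * pi / 2) = cos (real k * x - \<beta> * pi / 2)" for k
    using cos_mult_periodic[of k x 1 "\<beta> * pi / 2"] by simp
  then show ?thesis by (simp add: psi_def del: of_nat_Suc)
qed

lemma psi_borel_measurable [measurable]: "psi r \<beta> \<in> borel_measurable borel"
  by (rule borel_measurable_LIMSEQ_real[OF psi_partial_sums_tendsto]) measurable

lemma psi_partial_sums_bounded:
  obtains B where "\<And>n t. \<bar>\<Sum>k=1..n. 2 * cos (real k * t - \<beta> * pi / 2) / real k powr r\<bar> \<le> B"
    "\<And>t. \<bar>psi r \<beta> t\<bar> \<le> B"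
proof -
  obtain B where B: "\<And>n t. \<bar>\<Sum>k=1..n. 2 * cos (real k * t - \<beta> * pi / 2) / real k powr r\<bar> \<le> B"
    using trig_series_bounded_convergent(1)[OF r] by blast
  moreover have "\<bar>psi r \<beta> t\<bar> \<le> B" for t
    by (rule LIMSEQ_le_const2[OF tendsto_rabs[OF psi_partial_sums_tendsto]]) (use B in auto)
  ultimately show ?thesis using that by blast
qed

text \<open>The uniform bound on partial sums permits termwise integration. By orthogonality the
  integrals are constant from \<open>n = k\<close> on, only the frequency \<open>k\<close>
  surviving.\<close>

lemma psi_cos_integral:
  "(LINT y|period_measure. psi r \<beta> (y - t) * cos (real k * (x - y))) =
    (if k = 0 then 0 else 2 * pi * cos (real k * (x - t) - \<beta> * pi / 2) / real k powr r)"
proof -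
  let ?P = "\<lambda>n (s::real). \<Sum>j=1..n. 2 * cos (real j * s - \<beta> * pi / 2) / real j powr r"
  obtain B where B: "\<And>n s. \<bar>?P n s\<bar> \<le> B" "\<And>s. \<bar>psi r \<beta> s\<bar> \<le> B"
    using psi_partial_sums_bounded by blast
  have lim: "(\<lambda>n. LINT y|period_measure. ?P n (y - t) * cos (real k * (x - y))) \<longlonglongrightarrow>
      (LINT y|period_measure. psi r \<beta> (y - t) * cos (real k * (x - y)))"
  proof (rule integral_dominated_convergence[where w = "\<lambda>_. B"])
    show "AE y in period_measure. (\<lambda>n. ?P n (y - t) * cos (real k * (x - y))) \<longlonglongrightarrow> psi r \<beta> (y - t) * cos (real k * (x - y))"
      by (intro AE_I2 tendsto_mult psi_partial_sums_tendsto tendsto_const)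
    show "AE y in period_measure. norm (?P n (y - t) * cos (real k * (x - y))) \<le> B" for n
    proof (intro AE_I2)
      fix y
      have "\<bar>?P n (y - t)\<bar> * \<bar>cos (real k * (x - y))\<bar> \<le> B * 1"
        using B(1)[of "y - t" n] by (intro mult_mono) (auto intro: order.trans[OF abs_ge_zero])
      then show "norm (?P n (y - t) * cos (real k * (x - y))) \<le> B" by (simp add: abs_mult)
    qed
  qed (auto intro!: borel_imp_period_measurable)
  have ev: "\<forall>\<^sub>F n in sequentially. (LINT y|period_measure. ?P n (y - t) * cos (real k * (x - y))) =
      (if k = 0 then 0 else 2 * pi * cos (real k * (x - t) - \<beta> * pi / 2) / real k powr r)"
    using eventually_ge_at_top[of k]
  proof eventually_elim
    case (elim n)
    have int: "integrable period_measure (\<lambda>y. 2 * cos (real j * (y - t) - \<beta> * pi / 2) * cos (real k * (x - y)))" for j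
      by (rule period_integrable_bounded_borel[of _ 2]) (auto simp: abs_mult mult_le_one)
    have "(LINT y|period_measure. ?P n (y - t) * cos (real k * (x - y))) =
      (LINT y|period_measure. (\<Sum>j=1..n. (2 * cos (real j * (y - t) - \<beta> * pi / 2) * cos (real k * (x - y))) / real j powr r))"
      by (simp add: sum_distrib_right)
    also have "\<dots> = (\<Sum>j=1..n. (LINT y|period_measure. 2 * cos (real j * (y - t) - \<beta> * pi / 2) * cos (real k * (x - y))) / real j powr r)"
      using int by (subst Bochner_Integration.integral_sum) auto
    also have "\<dots> = (\<Sum>j=1..n. if j = k then 2 * pi * cos (real k * (x - t) - \<beta> * pi / 2) / real k powr r else 0)"
      by (intro sum.cong refl) (auto simp: integral_cos_cos)
    also have "\<dots> = (if k = 0 then 0 else 2 * pi * cos (real k * (x - t) - \<beta> * pi / 2) / real k powr r)"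
      using elim by (auto simp: sum.delta)
    finally show ?case .
  qed
  show ?thesis by (rule LIMSEQ_unique[OF lim tendsto_eventually[OF ev]])
qed

text \<open>Associativity of convolution: \<open>f\<close> is \<phi> convolved with
  \<open>psi\<close>, the mean is \<open>f\<close> convolved with \<open>V\<close>, and
  \<open>V\<close> convolved with \<open>psi\<close> is the finite sum \<open>P\<close>.\<close>

lemma deviation_as_convolution:
  fixes c :: "nat \<Rightarrow> real"
  assumes \<phi>: "\<phi> \<in> H1 p" and p: "p = 1 \<or> p = \<infinity>" and c: "\<And>k. k \<ge> N \<Longrightarrow> c k = 0"
    and f: "\<And>x. f x = 1 / (2 * pi) * (LINT t|period_measure. \<phi> (x - t) * psi r \<beta> t)"
  shows "complex_of_real (f x) - (\<Sum>\<^sub>\<infinity>k::int. complex_of_real (c (nat \<bar>k\<bar>)) * fourier_coeff f k * exp (\<i> * k * x)) =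
    complex_of_real (1 / (2 * pi) * (LINT t|period_measure. \<phi> t *
      (psi r \<beta> (x - t) - (\<Sum>k=1..N. c k * (2 * cos (real k * (x - t) - \<beta> * pi / 2) / real k powr r)))))"
proof -
  define V where "V s = c 0 + (\<Sum>k=1..N. c k * (2 * cos (real k * s)))" for s
  define P where "P s = (\<Sum>k=1..N. c k * (2 * cos (real k * s - \<beta> * pi / 2) / real k powr r))" for s
  obtain B where B: "\<And>s. \<bar>psi r \<beta> s\<bar> \<le> B" using psi_partial_sums_bounded by metis
  note \<phi>_int = H1_integrable[OF \<phi> p]
  note \<phi>\<psi>_int = convolution_integrable[OF \<phi>_int psi_borel_measurable B]
  have f_eq: "f x = 1 / (2 * pi) * (LINT t|period_measure. \<phi> t * psi r \<beta> (x - t))" for x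
  proof -
    have "psi r \<beta> (x - (t + 2 * pi)) = psi r \<beta> (x - t)" for t
      using psi_periodic[of "x - t - 2 * pi"] by (simp add: algebra_simps)
    then have "(LINT t|period_measure. \<phi> (x - t) * psi r \<beta> (x - (x - t))) = (LINT t|period_measure. \<phi> t * psi r \<beta> (x - t))"
      by (intro conjunct2[OF periodic_integral_reflect[OF _ \<phi>\<psi>_int]]) (simp only: H1_periodic[OF \<phi> p])
    then show ?thesis by (simp add: f)
  qed
  have f_borel: "f \<in> borel_measurable borel"
    unfolding f_eq[abs_def] using convolution_borel_measurable[OF _ psi_borel_measurable, of \<phi>] \<phi>_int by measurable
  have f_bd: "norm (f x) \<le> 1 / (2 * pi) * (LINT t|period_measure. \<bar>\<phi> t\<bar> * B)" for x
  proof -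
    have "\<bar>LINT t|period_measure. \<phi> t * psi r \<beta> (x - t)\<bar> \<le> (LINT t|period_measure. \<bar>\<phi> t * psi r \<beta> (x - t)\<bar>)"
      by (rule integral_abs_bound)
    also have "\<dots> \<le> (LINT t|period_measure. \<bar>\<phi> t\<bar> * B)"
      by (rule integral_mono') (use \<phi>_int B order.trans[OF abs_ge_zero B] in \<open>auto simp: abs_mult intro!: mult_left_mono\<close>)
    finally show ?thesis by (simp add: f_eq abs_mult divide_right_mono)
  qed
  have f_int: "integrable period_measure f"
    by (rule period_integrable_bounded_borel[OF f_borel f_bd])
  have V_borel: "(\<lambda>y. V (x - y)) \<in> borel_measurable borel" unfolding V_def by measurable
  have V_le: "\<bar>V s\<bar> \<le> \<bar>c 0\<bar> + (\<Sum>k=1..N. \<bar>c k\<bar> * 2)" for s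
  proof -
    have "\<bar>\<Sum>k=1..N. c k * (2 * cos (real k * s))\<bar> \<le> (\<Sum>k=1..N. \<bar>c k\<bar> * 2)"
      by (intro order.trans[OF sum_abs] sum_mono) (auto simp: abs_mult intro!: mult_left_le)
    then show ?thesis unfolding V_def by linarith
  qed
  \<comment> \<open>The term of \<open>V\<close> with \<open>c 0\<close> disappears because
    \<open>psi\<close> has mean zero.\<close>
  have \<psi>V: "(LINT y|period_measure. psi r \<beta> (y - t) * V (x - y)) = 2 * pi * P (x - t)" for t
  proof -
    have int: "integrable period_measure (\<lambda>y. psi r \<beta> (y - t) * cos (real k * (x - y)))" for k
    proof (rule period_integrable_bounded_borel)
      fix y
      have "\<bar>psi r \<beta> (y - t)\<bar> * \<bar>cos (real k * (x - y))\<bar> \<le> B * 1"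
        using B[of "y - t"] by (intro mult_mono) (auto intro: order.trans[OF abs_ge_zero])
      then show "norm (psi r \<beta> (y - t) * cos (real k * (x - y))) \<le> B" by (simp add: abs_mult)
    qed measurable
    have "(LINT y|period_measure. psi r \<beta> (y - t) * V (x - y)) =
      (LINT y|period_measure. c 0 * (psi r \<beta> (y - t) * cos (real 0 * (x - y))) +
        (\<Sum>k=1..N. c k * 2 * (psi r \<beta> (y - t) * cos (real k * (x - y)))))"
      by (simp add: V_def algebra_simps sum_distrib_left)
    also have "\<dots> = c 0 * (LINT y|period_measure. psi r \<beta> (y - t) * cos (real 0 * (x - y))) +
        (\<Sum>k=1..N. c k * 2 * (LINT y|period_measure. psi r \<beta> (y - t) * cos (real k * (x - y))))"
      using int int[of 0] by (subst Bochner_Integration.integral_add) (auto simp: Bochner_Integration.integral_sum)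
    also have "\<dots> = 2 * pi * P (x - t)"
      unfolding psi_cos_integral P_def by (auto simp: sum_distrib_left intro!: sum.cong)
    finally show ?thesis .
  qed
  have P_borel: "P \<in> borel_measurable borel" unfolding P_def by measurable
  have P_le: "\<bar>P s\<bar> \<le> (\<Sum>k=1..N. \<bar>c k\<bar> * (2 / real k powr r))" for s
    unfolding P_def
    by (intro order.trans[OF sum_abs] sum_mono) (auto simp: abs_mult intro!: mult_left_mono divide_right_mono)
  note \<phi>P_int = convolution_integrable[OF \<phi>_int P_borel P_le]
  have "(LINT y|period_measure. f y * V (x - y)) =
      1 / (2 * pi) * (LINT y|period_measure. (LINT t|period_measure. \<phi> t * psi r \<beta> (y - t)) *\<^sub>R V (x - y))"
    by (simp add: f_eq)
  also have "\<dots> = 1 / (2 * pi) * (LINT t|period_measure. \<phi> t *\<^sub>R (LINT y|period_measure. psi r \<beta> (y - t) *\<^sub>R V (x - y)))"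
    by (subst convolution_Fubini[OF \<phi>_int psi_borel_measurable B V_borel]) (use V_le in auto)
  also have "\<dots> = 1 / (2 * pi) * (LINT t|period_measure. (2 * pi) * (\<phi> t * P (x - t)))"
    by (simp only: \<psi>V real_scaleR_def mult.left_commute)
  also have "\<dots> = (LINT t|period_measure. \<phi> t * P (x - t))"
    unfolding integral_mult_right_zero by simp
  finally have "complex_of_real (f x) - (\<Sum>\<^sub>\<infinity>k::int. complex_of_real (c (nat \<bar>k\<bar>)) * fourier_coeff f k * exp (\<i> * k * x)) =
      complex_of_real (f x - 1 / (2 * pi) * (LINT t|period_measure. \<phi> t * P (x - t)))"
    using multiplier_mean_eq[where c = c and N = N and x = x, OF f_int c] by (simp add: V_def)
  also have "f x - 1 / (2 * pi) * (LINT t|period_measure. \<phi> t * P (x - t)) =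
      1 / (2 * pi) * (LINT t|period_measure. \<phi> t * (psi r \<beta> (x - t) - P (x - t)))"
    using \<phi>\<psi>_int[of x] \<phi>P_int[of x] by (simp add: f_eq right_diff_distrib diff_divide_distrib)
  finally show ?thesis by (simp only: P_def)
qed

end

section \<open>The kernel of the deviation\<close>

text \<open>With \<open>cos \<theta> = 0\<close> the factor \<open>sin \<theta>\<close> is 1 or -1.
  Carrying it along treats both residues of an odd \<beta> modulo 4 at once.\<close>

lemma sin_mult_cos_diff:
  fixes z \<theta> :: real
  assumes "cos \<theta> = 0"
  shows "sin \<theta> * cos (z - \<theta>) = sin z"
proof -
  have "(sin \<theta>)\<^sup>2 = 1" using assms by (simp add: sin_squared_eq)
  then have "sin \<theta> * (sin z * sin \<theta>) = sin z" by (simp add: power2_eq_square mult.left_commute)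
  then show ?thesis by (simp add: cos_diff assms)
qed

lemma cos_mult_cos_diff:
  fixes z \<theta> :: real
  assumes "sin \<theta> = 0"
  shows "cos \<theta> * cos (z - \<theta>) = cos z"
proof -
  have "(cos \<theta>)\<^sup>2 = 1" using assms by (simp add: cos_squared_eq)
  then have "cos \<theta> * (cos z * cos \<theta>) = cos z" by (simp add: power2_eq_square mult.left_commute)
  then show ?thesis by (simp add: cos_diff assms)
qed

lemma square_wave_odd:
  assumes "cos \<theta> = 0" "k \<ge> 1"
  shows "(LINT x|period_measure. sin \<theta> * sgn (sin x) * cos (real k * (x - y) - \<theta>)) =
    2 * (1 - (-1) ^ k) / real k * cos (real k * y)"
proof -
  have eq: "sin \<theta> * sgn (sin x) * cos (real k * (x - y) - \<theta>) = sgn (sin x) * sin (real k * x + (- (real k * y)))" for x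
    using sin_mult_cos_diff[OF assms(1), of "real k * (x - y)"] by (simp add: algebra_simps)
  show ?thesis
    unfolding eq using square_wave_sin_integral[OF assms(2), of "- (real k * y)"] by simp
qed

lemma square_wave_even:
  assumes "sin \<theta> = 0" "k \<ge> 1"
  shows "(LINT x|period_measure. cos \<theta> * sgn (cos x) * cos (real k * (x - y) - \<theta>)) =
    2 * cos (pi/2 - real k * pi/2) * (1 - (-1) ^ k) / real k * cos (real k * y)"
proof -
  have eq: "cos \<theta> * sgn (cos x) * cos (real k * (x - y) - \<theta>) = sgn (cos x) * cos (real k * x + (- (real k * y)))" for x
    using cos_mult_cos_diff[OF assms(1), of "real k * (x - y)"] by (simp add: algebra_simps)
  have "(LINT x|period_measure. cos \<theta> * sgn (cos x) * cos (real k * (x - y) - \<theta>)) =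
      2 * cos (- (real k * y) + pi/2 - real k * pi/2) * (1 - (-1) ^ k) / real k"
    unfolding eq using square_wave_cos_integral[OF assms(2), of "- (real k * y)"] by simp
  also have "\<dots> = 2 * cos (pi/2 - real k * pi/2) * (1 - (-1) ^ k) / real k * cos (real k * y)"
  proof (cases "even k")
    case False
    \<comment> \<open>For odd \<open>k\<close> the additional phase is a multiple of
      \<open>pi\<close>, whose sine vanishes, so the dependence on \<open>y\<close> splits off as a
      cosine.\<close>
    then obtain j where "k = 2 * j + 1" by (elim oddE)
    then have "pi/2 - real k * pi/2 = - (real j * pi)" by (simp add: field_simps)
    moreover from this have "- (real k * y) + pi/2 - real k * pi/2 = - (real k * y) - real j * pi" by linarith
    ultimately show ?thesis by (simp only: cos_diff) (simp add: mult_ac)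
  qed simp
  finally show ?thesis .
qed

context convex_multiplier
begin

text \<open>The kernel \<phi> is convolved with in the deviation. As \<open>psi\<close> minus a
  finite sum it inherits measurability, periodicity and boundedness; \<open>kernel_tendsto\<close>
  recovers the series with coefficients \<open>1 - c k\<close>.\<close>

definition kernel :: "real \<Rightarrow> real \<Rightarrow> real \<Rightarrow> real" where
  "kernel r \<beta> s = psi r \<beta> s - (\<Sum>k=1..N. c k * (2 * cos (real k * s - \<beta> * pi / 2) / real k powr r))"

context
  fixes r \<beta> :: real
  assumes r: "r = 1 \<and> cos (\<beta> * pi / 2) = 0 \<or> r \<ge> 2"
begin

lemma kernel_partial_sum_eq:
  assumes "n \<ge> N"
  shows "(\<Sum>k=1..n. (1 - c k) * (2 * cos (real k * s - \<beta> * pi / 2) / real k powr r)) =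
    (\<Sum>k=1..n. 2 * cos (real k * s - \<beta> * pi / 2) / real k powr r) -
    (\<Sum>k=1..N. c k * (2 * cos (real k * s - \<beta> * pi / 2) / real k powr r))"
proof -
  have "(\<Sum>k=1..N. c k * (2 * cos (real k * s - \<beta> * pi / 2) / real k powr r)) =
      (\<Sum>k=1..n. c k * (2 * cos (real k * s - \<beta> * pi / 2) / real k powr r))"
    using assms by (intro sum.mono_neutral_left) (auto simp: c_zero)
  then show ?thesis by (simp only: left_diff_distrib sum_subtractf mult_1)
qed

lemma kernel_tendsto:
  "(\<lambda>n. \<Sum>k=1..n. (1 - c k) * (2 * cos (real k * s - \<beta> * pi / 2) / real k powr r)) \<longlonglongrightarrow> kernel r \<beta> s"
proof (rule Lim_transform_eventually)
  show "(\<lambda>n. (\<Sum>k=1..n. 2 * cos (real k * s - \<beta> * pi / 2) / real k powr r) -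
    (\<Sum>k=1..N. c k * (2 * cos (real k * s - \<beta> * pi / 2) / real k powr r))) \<longlonglongrightarrow> kernel r \<beta> s"
    unfolding kernel_def by (intro tendsto_diff tendsto_const psi_partial_sums_tendsto[OF r])
  show "\<forall>\<^sub>F n in sequentially. (\<Sum>k=1..n. 2 * cos (real k * s - \<beta> * pi / 2) / real k powr r) -
    (\<Sum>k=1..N. c k * (2 * cos (real k * s - \<beta> * pi / 2) / real k powr r)) =
    (\<Sum>k=1..n. (1 - c k) * (2 * cos (real k * s - \<beta> * pi / 2) / real k powr r))"
    using eventually_ge_at_top[of N] by eventually_elim (simp only: kernel_partial_sum_eq)
qed

lemma kernel_bounded:
  obtains B where "\<And>n s. n \<ge> N \<Longrightarrow> \<bar>\<Sum>k=1..n. (1 - c k) * (2 * cos (real k * s - \<beta> * pi / 2) / real k powr r)\<bar> \<le> B"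
    "\<And>s. \<bar>kernel r \<beta> s\<bar> \<le> B"
proof -
  obtain B where B: "\<And>n s. \<bar>\<Sum>k=1..n. 2 * cos (real k * s - \<beta> * pi / 2) / real k powr r\<bar> \<le> B"
    "\<And>s. \<bar>psi r \<beta> s\<bar> \<le> B" using psi_partial_sums_bounded[OF r] by blast
  define D where "D = (\<Sum>k=1..N. \<bar>c k\<bar> * (2 / real k powr r))"
  have D: "\<bar>\<Sum>k=1..N. c k * (2 * cos (real k * s - \<beta> * pi / 2) / real k powr r)\<bar> \<le> D" for s
    unfolding D_def
    by (intro order.trans[OF sum_abs] sum_mono) (auto simp: abs_mult intro!: mult_left_mono divide_right_mono)
  have le: "\<bar>x - y\<bar> \<le> B + D" if "\<bar>x\<bar> \<le> B" "\<bar>y\<bar> \<le> D" for x y using that by linarith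
  show ?thesis
  proof (rule that[of "B + D"])
    show "\<bar>\<Sum>k=1..n. (1 - c k) * (2 * cos (real k * s - \<beta> * pi / 2) / real k powr r)\<bar> \<le> B + D" if "n \<ge> N" for n s
      unfolding kernel_partial_sum_eq[OF that] by (intro le B D)
    show "\<bar>kernel r \<beta> s\<bar> \<le> B + D" for s unfolding kernel_def by (intro le B D)
  qed
qed

lemma kernel_borel_measurable: "kernel r \<beta> \<in> borel_measurable borel"
  unfolding kernel_def[abs_def] using psi_borel_measurable[OF r] by measurable

lemma kernel_periodic: "kernel r \<beta> (x + 2 * pi) = kernel r \<beta> x"
  using cos_mult_periodic[of _ x 1 "\<beta> * pi / 2"] by (simp add: kernel_def psi_periodic[OF r])

text \<open>At \<open>0\<close> the real power and the quotient are junk, and \<open>A 0 = 0\<close>.\<close>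

lemma square_wave_correlation:
  fixes \<tau> a :: "_ \<Rightarrow> real"
  assumes \<tau>: "\<tau> \<in> borel_measurable borel" and \<tau>_le: "\<And>x. \<bar>\<tau> x\<bar> \<le> 1"
    and coeff: "\<And>k y. k \<ge> 1 \<Longrightarrow> (LINT x|period_measure. \<tau> x * cos (real k * (x - y) - \<beta> * pi / 2)) = a k * cos (real k * y)"
    and a_le: "\<And>k. k \<ge> 1 \<Longrightarrow> \<bar>a k\<bar> \<le> 4 / real k"
  defines "A \<equiv> \<lambda>k. (1 - c k) * a k / (pi * real k powr r)"
  defines "h \<equiv> \<lambda>y. 1 / (2 * pi) * (LINT x|period_measure. \<tau> x * kernel r \<beta> (x - y))"
  shows "A sums h 0" and "isCont h 0"
proof -
  note [measurable] = \<tau> kernel_borel_measurable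
  let ?P = "\<lambda>n (s::real). \<Sum>k=1..n. (1 - c k) * (2 * cos (real k * s - \<beta> * pi / 2) / real k powr r)"
  obtain B where B: "\<And>n s. n \<ge> N \<Longrightarrow> \<bar>?P n s\<bar> \<le> B" "\<And>s. \<bar>kernel r \<beta> s\<bar> \<le> B"
    using kernel_bounded by blast
  have A0: "A 0 = 0" by (simp add: A_def)
  have h_lim: "(\<lambda>n. \<Sum>k<n. A k * cos (real k * y)) \<longlonglongrightarrow> h y" for y
  proof -
    \<comment> \<open>The index is shifted by \<open>N\<close> because the uniform bound on the
      partial sums holds only from \<open>N\<close> on; the shift is removed at the end.\<close>
    have "(\<lambda>n. 1 / (2 * pi) * (LINT x|period_measure. \<tau> x * ?P (n + N) (x - y))) \<longlonglongrightarrow> h y"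
      unfolding h_def
    proof (intro tendsto_mult tendsto_const integral_dominated_convergence[where w = "\<lambda>_. B"])
      show "AE x in period_measure. (\<lambda>n. \<tau> x * ?P (n + N) (x - y)) \<longlonglongrightarrow> \<tau> x * kernel r \<beta> (x - y)"
        by (intro AE_I2 tendsto_mult tendsto_const LIMSEQ_ignore_initial_segment kernel_tendsto)
      show "AE x in period_measure. norm (\<tau> x * ?P (n + N) (x - y)) \<le> B" for n
      proof (intro AE_I2)
        fix x
        have "\<bar>\<tau> x\<bar> * \<bar>?P (n + N) (x - y)\<bar> \<le> 1 * B"
          by (intro mult_mono B \<tau>_le) auto
        then show "norm (\<tau> x * ?P (n + N) (x - y)) \<le> B" by (simp add: abs_mult)
      qed
      show "(\<lambda>x. \<tau> x * kernel r \<beta> (x - y)) \<in> borel_measurable period_measure"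
        by (intro borel_imp_period_measurable) measurable
      show "(\<lambda>x. \<tau> x * ?P (n + N) (x - y)) \<in> borel_measurable period_measure" for n
        by (intro borel_imp_period_measurable) measurable
    qed simp
    moreover have "1 / (2 * pi) * (LINT x|period_measure. \<tau> x * ?P n (x - y)) = (\<Sum>k<Suc n. A k * cos (real k * y))" for n
    proof -
      have int: "integrable period_measure (\<lambda>x. \<tau> x * cos (real k * (x - y) - \<beta> * pi / 2))" for k
        by (rule period_integrable_bounded_borel[of _ 1])
          (use \<tau> \<tau>_le in \<open>auto simp: abs_mult intro!: mult_le_one\<close>)
      have "(LINT x|period_measure. \<tau> x * ?P n (x - y)) =
        (LINT x|period_measure. (\<Sum>k=1..n. 2 * (1 - c k) / real k powr r * (\<tau> x * cos (real k * (x - y) - \<beta> * pi / 2))))"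
        unfolding sum_distrib_left by (intro Bochner_Integration.integral_cong refl sum.cong) (simp add: field_simps)
      also have "\<dots> = (\<Sum>k=1..n. 2 * (1 - c k) / real k powr r * (LINT x|period_measure. \<tau> x * cos (real k * (x - y) - \<beta> * pi / 2)))"
        using int by (subst Bochner_Integration.integral_sum) auto
      also have "\<dots> = (\<Sum>k=1..n. 2 * (1 - c k) / real k powr r * (a k * cos (real k * y)))"
        by (intro sum.cong refl) (simp add: coeff)
      also have "\<dots> = 2 * pi * (\<Sum>k=1..n. A k * cos (real k * y))"
        unfolding sum_distrib_left A_def by (intro sum.cong refl) (simp add: field_simps)
      also have "(\<Sum>k=1..n. A k * cos (real k * y)) = (\<Sum>k<Suc n. A k * cos (real k * y))"
        by (simp add: sum.lessThan_Suc_shift sum.atLeast1_atMost_eq A0 del: sum.lessThan_Suc)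
      finally show ?thesis by simp
    qed
    ultimately have "(\<lambda>n. \<Sum>k<n + Suc N. A k * cos (real k * y)) \<longlonglongrightarrow> h y" by simp
    then show ?thesis by (rule LIMSEQ_offset)
  qed
  from h_lim[of 0] show "A sums h 0" by (simp add: sums_def)
  \<comment> \<open>One factor \<open>1 / k\<close> comes from \<open>a\<close>, another from
    \<open>real k powr r\<close> with \<open>r \<ge> 1\<close>. The quadratic decay gives uniform
    convergence by the Weierstrass test, hence continuity of \<open>h\<close>.\<close>
  have A_le: "\<bar>A k\<bar> \<le> 4 * real k powr (-2)" for k
  proof (cases "k = 0")
    case False
    then have k: "k \<ge> 1" by simp
    have "\<bar>1 - c k\<bar> \<le> 1" using c_le_1 c_nonneg by (auto simp: abs_le_iff algebra_simps intro: order.trans)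
    then have "\<bar>1 - c k\<bar> * \<bar>a k\<bar> \<le> 1 * (4 / real k)" by (intro mult_mono a_le k) auto
    moreover have "real k powr 1 \<le> real k powr r" using r k by (intro powr_mono) auto
    then have "1 * real k \<le> pi * real k powr r" using k pi_ge_two by (intro mult_mono) auto
    ultimately have "\<bar>A k\<bar> \<le> (4 / real k) / real k"
      unfolding A_def abs_mult abs_divide using k by (intro frac_le) auto
    also have "\<dots> = 4 * real k powr (-2)" using k by (simp add: powr_minus powr_numeral power2_eq_square field_simps)
    finally show ?thesis .
  qed (simp add: A0)
  have "uniform_limit UNIV (\<lambda>n y. \<Sum>k<n. A k * cos (real k * y)) (\<lambda>y. \<Sum>k. A k * cos (real k * y)) sequentially"
  proof (rule Weierstrass_m_test)
    show "norm (A k * cos (real k * y)) \<le> 4 * real k powr (-2)" for k y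
      using order.trans[OF mult_left_le[of "\<bar>cos (real k * y)\<bar>" "\<bar>A k\<bar>"] A_le[of k]] by (simp add: abs_mult)
    show "summable (\<lambda>k. 4 * real k powr (-2))" by (intro summable_mult) (simp add: summable_real_powr_iff)
  qed
  moreover have "(\<lambda>y. \<Sum>k. A k * cos (real k * y)) = h"
    using h_lim by (auto simp: sums_def[symmetric] sums_iff)
  ultimately have "uniform_limit UNIV (\<lambda>n y. \<Sum>k<n. A k * cos (real k * y)) h sequentially" by simp
  then have "continuous_on UNIV h"
    by (rule uniform_limit_theorem[rotated]) (auto intro!: always_eventually continuous_intros)
  then show "isCont h 0" by (simp add: continuous_on_eq_continuous_at)
qed

text \<open>The square wave \<tau> fixes the supremum as \<open>h 0\<close>, and its correlation
  with the kernel expands \<open>h 0\<close> in a series. Obtaining \<open>S\<close> keeps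
  convergence of the series together with its value.\<close>

lemma approx_error_eq_correlation:
  fixes \<tau> a :: "_ \<Rightarrow> real"
  assumes p: "p = 1 \<or> p = \<infinity>"
    and \<tau>: "\<tau> \<in> borel_measurable borel" and \<tau>_le: "\<And>x. \<bar>\<tau> x\<bar> \<le> 1" and \<tau>_anti: "\<And>x. \<tau> (x + pi) = - \<tau> x"
    and sign: "\<And>t. t \<in> {-pi..pi} \<Longrightarrow> \<tau> t * (kernel r \<beta> t - C) = \<bar>kernel r \<beta> t - C\<bar>"
    and coeff: "\<And>k y. k \<ge> 1 \<Longrightarrow> (LINT x|period_measure. \<tau> x * cos (real k * (x - y) - \<beta> * pi / 2)) = a k * cos (real k * y)"
    and a_le: "\<And>k. k \<ge> 1 \<Longrightarrow> \<bar>a k\<bar> \<le> 4 / real k"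
    and a_even: "\<And>k. even k \<Longrightarrow> a k = 0"
  obtains S where "(\<lambda>j. (1 - c (2 * j + 1)) * a (2 * j + 1) / (pi * real (2 * j + 1) powr r)) sums S"
    and "approx_error (W_class r \<beta> p)
      (\<lambda>f x. \<Sum>\<^sub>\<infinity>k::int. complex_of_real (c (nat \<bar>k\<bar>)) * fourier_coeff f k * exp (\<i> * k * x)) p = ereal S"
proof -
  define h where "h = (\<lambda>y. 1 / (2 * pi) * (LINT x|period_measure. \<tau> x * kernel r \<beta> (x - y)))"
  obtain B where B: "\<And>s. \<bar>kernel r \<beta> s\<bar> \<le> B" using kernel_bounded by metis
  have "approx_error (W_class r \<beta> p)
      (\<lambda>f x. \<Sum>\<^sub>\<infinity>k::int. complex_of_real (c (nat \<bar>k\<bar>)) * fourier_coeff f k * exp (\<i> * k * x)) p =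
    (SUP \<phi>\<in>H1 p. Lp_norm p (\<lambda>x. 1 / (2 * pi) * (LINT t|period_measure. \<phi> t * kernel r \<beta> (x - t))))"
    unfolding approx_error_def W_class_def image_image
  proof (intro SUP_cong refl)
    fix \<phi> assume \<phi>: "\<phi> \<in> H1 p"
    define f where "f = (\<lambda>x. 1 / (2 * pi) * (LINT t|period_measure. \<phi> (x - t) * psi r \<beta> t))"
    have dev: "complex_of_real (f x) - (\<Sum>\<^sub>\<infinity>k::int. complex_of_real (c (nat \<bar>k\<bar>)) * fourier_coeff f k * exp (\<i> * k * x)) =
        complex_of_real (1 / (2 * pi) * (LINT t|period_measure. \<phi> t * kernel r \<beta> (x - t)))" for x
      unfolding kernel_def
      by (rule deviation_as_convolution[where c = c and N = N, OF r \<phi> p c_zero]) (simp_all add: f_def)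
    have "Lp_norm p (\<lambda>x. complex_of_real (f x) -
        (\<Sum>\<^sub>\<infinity>k::int. complex_of_real (c (nat \<bar>k\<bar>)) * fourier_coeff f k * exp (\<i> * k * x))) =
      Lp_norm p (\<lambda>x. 1 / (2 * pi) * (LINT t|period_measure. \<phi> t * kernel r \<beta> (x - t)))"
      unfolding dev Lp_norm_def norm_of_real real_norm_def ..
    then show "Lp_norm p (\<lambda>x. complex_of_real (1 / (2 * pi) * (LINT t|period_measure. \<phi> (x - t) * psi r \<beta> t)) -
        (\<Sum>\<^sub>\<infinity>k::int. complex_of_real (c (nat \<bar>k\<bar>)) *
          fourier_coeff (\<lambda>x. 1 / (2 * pi) * (LINT t|period_measure. \<phi> (x - t) * psi r \<beta> t)) k * exp (\<i> * k * x))) =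
      Lp_norm p (\<lambda>x. 1 / (2 * pi) * (LINT t|period_measure. \<phi> t * kernel r \<beta> (x - t)))"
      unfolding f_def .
  qed
  also have "\<dots> = ereal (h 0)"
    using square_wave_correlation(2)[OF \<tau> \<tau>_le coeff a_le]
    by (intro convolution_norm_sup[OF p kernel_borel_measurable kernel_periodic B \<tau> \<tau>_le \<tau>_anti sign])
      (simp_all add: h_def)
  finally have "approx_error (W_class r \<beta> p)
      (\<lambda>f x. \<Sum>\<^sub>\<infinity>k::int. complex_of_real (c (nat \<bar>k\<bar>)) * fourier_coeff f k * exp (\<i> * k * x)) p = ereal (h 0)" .
  \<comment> \<open>Even frequencies have coefficient 0, so the series can be indexed by the odd
    numbers.\<close>
  moreover have "(\<lambda>j. (1 - c (2 * j + 1)) * a (2 * j + 1) / (pi * real (2 * j + 1) powr r)) sums h 0"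
  proof (subst sums_mono_reindex[of "\<lambda>j. 2 * j + 1"])
    show "(\<lambda>k. (1 - c k) * a k / (pi * real k powr r)) sums h 0"
      unfolding h_def by (rule square_wave_correlation(1)[OF \<tau> \<tau>_le coeff a_le])
    fix k :: nat assume "k \<notin> range (\<lambda>j. 2 * j + 1)"
    then have "even k" by (metis oddE rangeI)
    then show "(1 - c k) * a k / (pi * real k powr r) = 0" by (simp add: a_even)
  qed (auto intro: strict_monoI)
  ultimately show ?thesis using that by blast
qed

end

end

section \<open>Sign of the kernel and exact error for a convex multiplier\<close>

context convex_multiplier
begin

lemma kernel_tendsto_sin:
  assumes "r = 1 \<or> r \<ge> 2" "cos (\<beta> * pi / 2) = 0"
  shows "(\<lambda>n. \<Sum>k=1..n. (1 - c k) / real k powr r * sin (real k * t)) \<longlonglongrightarrow> sin (\<beta> * pi / 2) * kernel r \<beta> t / 2"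
proof -
  let ?s = "sin (\<beta> * pi / 2)"
  have "(\<lambda>n. ?s * (\<Sum>k=1..n. (1 - c k) * (2 * cos (real k * t - \<beta> * pi / 2) / real k powr r)) / 2) \<longlonglongrightarrow> ?s * kernel r \<beta> t / 2"
    using assms by (intro tendsto_mult tendsto_divide tendsto_const kernel_tendsto) auto
  moreover have "?s * (\<Sum>k=1..n. (1 - c k) * (2 * cos (real k * t - \<beta> * pi / 2) / real k powr r)) / 2 =
      (\<Sum>k=1..n. (1 - c k) / real k powr r * sin (real k * t))" for n
    unfolding sum_distrib_left sum_divide_distrib
  proof (intro sum.cong refl)
    fix k
    show "?s * ((1 - c k) * (2 * cos (real k * t - \<beta> * pi / 2) / real k powr r)) / 2 =
        (1 - c k) / real k powr r * sin (real k * t)"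
      using arg_cong[OF sin_mult_cos_diff[OF assms(2), of "real k * t"], of "(*) ((1 - c k) / real k powr r)"]
      by (simp add: mult_ac)
  qed
  ultimately show ?thesis by simp
qed

lemma kernel_tendsto_cos:
  assumes "r \<ge> 2" "sin (\<beta> * pi / 2) = 0"
  shows "(\<lambda>n. \<Sum>k=1..n. (1 - c k) / real k powr r * cos (real k * t)) \<longlonglongrightarrow> cos (\<beta> * pi / 2) * kernel r \<beta> t / 2"
proof -
  let ?s = "cos (\<beta> * pi / 2)"
  have "(\<lambda>n. ?s * (\<Sum>k=1..n. (1 - c k) * (2 * cos (real k * t - \<beta> * pi / 2) / real k powr r)) / 2) \<longlonglongrightarrow> ?s * kernel r \<beta> t / 2"
    using assms by (intro tendsto_mult tendsto_divide tendsto_const kernel_tendsto) auto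
  moreover have "?s * (\<Sum>k=1..n. (1 - c k) * (2 * cos (real k * t - \<beta> * pi / 2) / real k powr r)) / 2 =
      (\<Sum>k=1..n. (1 - c k) / real k powr r * cos (real k * t))" for n
    unfolding sum_distrib_left sum_divide_distrib
  proof (intro sum.cong refl)
    fix k
    show "?s * ((1 - c k) * (2 * cos (real k * t - \<beta> * pi / 2) / real k powr r)) / 2 =
        (1 - c k) / real k powr r * cos (real k * t)"
      using arg_cong[OF cos_mult_cos_diff[OF assms(2), of "real k * t"], of "(*) ((1 - c k) / real k powr r)"]
      by (simp add: mult_ac)
  qed
  ultimately show ?thesis by simp
qed

text \<open>After removing its sign the kernel is an odd sine series, nonnegative on the right half
  of the period; the constant to subtract is 0.\<close>

lemma kernel_sign_sin:
  assumes r: "r = 1 \<or> r \<ge> 2" and cos0: "cos (\<beta> * pi / 2) = 0" and t: "t \<in> {-pi..pi}"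
  shows "sin (\<beta> * pi / 2) * sgn (sin t) * kernel r \<beta> t = \<bar>kernel r \<beta> t\<bar>"
proof -
  let ?s = "sin (\<beta> * pi / 2)"
  define L where "L t = ?s * kernel r \<beta> t / 2" for t
  note L = kernel_tendsto_sin[OF r cos0, folded L_def]
  have "?s\<^sup>2 = 1" using cos0 by (simp add: sin_squared_eq)
  then have "\<bar>?s\<bar> = 1" by (simp add: abs_square_eq_1)
  then have "\<bar>kernel r \<beta> t\<bar> = 2 * \<bar>L t\<bar>" by (simp add: L_def abs_mult)
  moreover have "?s * sgn (sin t) * kernel r \<beta> t = 2 * (sgn (sin t) * L t)" by (simp add: L_def)
  moreover have "sgn (sin t) * L t = \<bar>L t\<bar>"
  proof -
    have pos: "0 \<le> L x" if "0 < x" "x \<le> pi" for x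
      using sine_series_nonneg[OF r that L] .
    have odd: "L (- x) = - L x" for x
      using LIMSEQ_unique[OF L[of "- x"]] tendsto_minus[OF L[of x]] by (simp add: sum_negf)
    \<comment> \<open>At \<open>pi\<close> and \<open>- pi\<close> the square wave is 0, so the
      kernel has to vanish there too.\<close>
    have "sin (real k * pi) = 0" for k by simp
    then have Lpi: "L pi = 0" using LIMSEQ_unique[OF L[of pi]] by simp
    consider "t = 0" | "t = pi" | "t = - pi" | "0 < t" "t < pi" | "- pi < t" "t < 0" using t by fastforce
    then show ?thesis
    proof cases
      case 1
      then show ?thesis using odd[of 0] by simp
    next
      case 4
      then show ?thesis using pos[of t] sin_gt_zero[of t] by simp
    next
      case 5
      then show ?thesis using pos[of "- t"] sin_gt_zero[of "- t"] odd[of t] by simp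
    qed (use Lpi odd[of pi] in auto)
  qed
  ultimately show ?thesis by simp
qed

text \<open>After removing its sign the kernel is even and decreases on the right half of the
  period, so it passes its value at \<open>pi/2\<close> where the cosine changes sign.\<close>

lemma kernel_sign_cos:
  assumes r: "r = 2 \<or> r \<ge> 3" and sin0: "sin (\<beta> * pi / 2) = 0" and t: "t \<in> {-pi..pi}"
  shows "cos (\<beta> * pi / 2) * sgn (cos t) * (kernel r \<beta> t - kernel r \<beta> (pi/2)) = \<bar>kernel r \<beta> t - kernel r \<beta> (pi/2)\<bar>"
proof -
  let ?s = "cos (\<beta> * pi / 2)"
  define L where "L t = ?s * kernel r \<beta> t / 2" for t
  have r2: "r \<ge> 2" using r by auto
  note L = kernel_tendsto_cos[OF r2 sin0, folded L_def]
  have "?s\<^sup>2 = 1" using sin0 by (simp add: cos_squared_eq)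
  then have "\<bar>?s\<bar> = 1" by (simp add: abs_square_eq_1)
  moreover have "2 * (L t - L (pi/2)) = ?s * (kernel r \<beta> t - kernel r \<beta> (pi/2))"
    by (simp add: L_def right_diff_distrib)
  ultimately have "\<bar>kernel r \<beta> t - kernel r \<beta> (pi/2)\<bar> = \<bar>2 * (L t - L (pi/2))\<bar>" by (simp add: abs_mult)
  moreover have "?s * sgn (cos t) * (kernel r \<beta> t - kernel r \<beta> (pi/2)) = 2 * (sgn (cos t) * (L t - L (pi/2)))"
    by (simp add: L_def field_simps)
  moreover have "sgn (cos t) * (L t - L (pi/2)) = \<bar>L t - L (pi/2)\<bar>"
  proof -
    have even: "L (- x) = L x" for x
      using LIMSEQ_unique[OF L[of "- x"]] L[of x] by simp
    have anti: "L y \<le> L x" if "0 < x" "x \<le> y" "y \<le> pi" for x y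
      using cosine_series_antimono[OF r that L L] .
    \<comment> \<open>Monotonicity is available for positive arguments only. At 0 every cosine
      attains its maximum 1, so the series are compared term by term.\<close>
    have L0: "L (pi/2) \<le> L 0"
    proof (rule LIMSEQ_le[OF L[of "pi/2"] L[of 0]], intro exI allI impI sum_mono)
      fix k
      show "(1 - c k) / real k powr r * cos (real k * (pi/2)) \<le> (1 - c k) / real k powr r * cos (real k * 0)"
        using c_le_1[of k] by (intro mult_left_mono) auto
    qed
    have "L t = L \<bar>t\<bar>" "cos t = cos \<bar>t\<bar>" using even[of t] by (auto simp: abs_if)
    moreover have "sgn (cos x) * (L x - L (pi/2)) = \<bar>L x - L (pi/2)\<bar>" if x: "0 \<le> x" "x \<le> pi" for x
    proof -
      consider "x = 0" | "0 < x" "x < pi/2" | "x = pi/2" | "pi/2 < x" using x by linarith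
      then show ?thesis
      proof cases
        case 2
        then show ?thesis using anti[of x "pi/2"] cos_gt_zero[of x] by simp
      next
        case 4
        then have "cos x < 0" using cos_monotone_0_pi[of "pi/2" x] x by simp
        then show ?thesis using anti[of "pi/2" x] 4 x by simp
      next
        case 3
        then show ?thesis by (simp only:) simp
      qed (use L0 in auto)
    qed
    ultimately show ?thesis using t by (metis abs_ge_zero abs_le_iff atLeastAtMost_iff minus_le_iff)
  qed
  ultimately show ?thesis by (simp only: abs_mult abs_numeral)
qed

text \<open>The square wave coefficients contribute the additional factor
  \<open>1 / (2 * k + 1)\<close>, raising the exponent to \<open>r + 1\<close>, and for even \<beta>
  the alternating sign. An integer power is used since \<open>\<beta> + 1\<close> may be
  negative.\<close>

lemma approx_error_multiplier:
  fixes \<beta> :: int and r :: real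
  assumes p: "p = 1 \<or> p = \<infinity>"
    and cases: "(odd \<beta> \<and> (r = 1 \<or> r \<ge> 2)) \<or> (even \<beta> \<and> (r = 2 \<or> r \<ge> 3))"
  shows "approx_error (W_class r \<beta> p)
      (\<lambda>f x. \<Sum>\<^sub>\<infinity>k::int. complex_of_real (c (nat \<bar>k\<bar>)) * fourier_coeff f k * exp (\<i> * k * x)) p =
    ereal (4 / pi * (\<Sum>k. (-1) powi (int k * (\<beta> + 1)) / real (2 * k + 1) powr (r + 1) * (1 - c (2 * k + 1))))"
proof -
  let ?X = "\<lambda>k. (-1) powi (int k * (\<beta> + 1)) / real (2 * k + 1) powr (r + 1) * (1 - c (2 * k + 1))"
  let ?E = "approx_error (W_class r \<beta> p)
      (\<lambda>f x. \<Sum>\<^sub>\<infinity>k::int. complex_of_real (c (nat \<bar>k\<bar>)) * fourier_coeff f k * exp (\<i> * k * x)) p"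
  \<comment> \<open>Common end of both parities: the coefficients at odd indices are inserted and
    the sum is rescaled by \<open>pi / 4\<close>.\<close>
  have fin: ?thesis
    if S: "(\<lambda>j. (1 - c (2 * j + 1)) * a (2 * j + 1) / (pi * real (2 * j + 1) powr r)) sums S" and E: "?E = ereal S"
      and a: "\<And>j. a (2 * j + 1) = 4 * (-1) powi (int j * (\<beta> + 1)) / real (2 * j + 1)" for a S
  proof -
    have "(1 - c (2 * j + 1)) * a (2 * j + 1) / (pi * real (2 * j + 1) powr r) = 4 / pi * ?X j" for j
    proof -
      have "real (2 * j + 1) powr (r + 1) = real (2 * j + 1) powr r * real (2 * j + 1)"
        by (simp add: powr_add)
      then show ?thesis unfolding a by (simp only:) (simp add: field_simps)
    qed
    with S have "(\<lambda>j. 4 / pi * ?X j) sums S" by simp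
    from sums_mult[OF this, of "pi / 4"] have "?X sums (pi / 4 * S)" by simp
    then have "4 / pi * (\<Sum>j. ?X j) = S" by (simp only: sums_unique[symmetric]) simp
    then show ?thesis using E by simp
  qed
  have abs_le: "\<bar>1 - (- 1 :: real) ^ k\<bar> \<le> 2" for k :: nat by (cases "even k") auto
  show ?thesis
  proof (cases "odd \<beta>")
    case True
    with cases have r: "r = 1 \<or> r \<ge> 2" by auto
    have cos0: "cos (of_int \<beta> * pi / 2) = 0" using True by (auto simp: cos_zero_iff_int)
    define a where "a k = 2 * (1 - (-1) ^ k) / real k" for k :: nat
    obtain S where "(\<lambda>j. (1 - c (2 * j + 1)) * a (2 * j + 1) / (pi * real (2 * j + 1) powr r)) sums S" "?E = ereal S"
    proof (rule approx_error_eq_correlation[of r "of_int \<beta>" p "\<lambda>x. sin (of_int \<beta> * pi / 2) * sgn (sin x)" 0 a])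
      show "\<bar>sin (of_int \<beta> * pi / 2) * sgn (sin x)\<bar> \<le> 1" for x
        by (auto simp: abs_mult sgn_if)
      show "\<bar>a k\<bar> \<le> 4 / real k" for k
        using abs_le[of k] by (simp add: a_def abs_mult divide_right_mono)
      show "(LINT x|period_measure. sin (of_int \<beta> * pi / 2) * sgn (sin x) * cos (real k * (x - y) - of_int \<beta> * pi / 2)) =
          a k * cos (real k * y)" if "k \<ge> 1" for k y
        unfolding a_def by (rule square_wave_odd[OF cos0 that])
      show "sin (of_int \<beta> * pi / 2) * sgn (sin t) * (kernel r (of_int \<beta>) t - 0) = \<bar>kernel r (of_int \<beta>) t - 0\<bar>"
        if "t \<in> {-pi..pi}" for t
        using kernel_sign_sin[OF r cos0 that] by simp
    qed (use r cos0 p in \<open>auto simp: a_def\<close>)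
    then show ?thesis
    proof (rule fin)
      fix j
      have "even (int j * (\<beta> + 1))" using True by simp
      then show "a (2 * j + 1) = 4 * (-1) powi (int j * (\<beta> + 1)) / real (2 * j + 1)"
        by (simp add: a_def power_int_minus_left_even)
    qed
  next
    case False
    with cases have r: "r = 2 \<or> r \<ge> 3" by auto
    have sin0: "sin (of_int \<beta> * pi / 2) = 0" using False by (auto simp: sin_zero_iff_int)
    define a where "a k = 2 * cos (pi/2 - real k * pi/2) * (1 - (-1) ^ k) / real k" for k :: nat
    obtain S where "(\<lambda>j. (1 - c (2 * j + 1)) * a (2 * j + 1) / (pi * real (2 * j + 1) powr r)) sums S" "?E = ereal S"
    proof (rule approx_error_eq_correlation[of r "of_int \<beta>" p "\<lambda>x. cos (of_int \<beta> * pi / 2) * sgn (cos x)"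
          "kernel r (of_int \<beta>) (pi/2)" a])
      show "\<bar>cos (of_int \<beta> * pi / 2) * sgn (cos x)\<bar> \<le> 1" for x
        by (auto simp: abs_mult sgn_if)
      show "\<bar>a k\<bar> \<le> 4 / real k" for k
      proof -
        have "\<bar>cos (pi/2 - real k * pi/2)\<bar> * \<bar>1 - (- 1 :: real) ^ k\<bar> \<le> 1 * 2"
          by (intro mult_mono abs_le) auto
        then have "2 * \<bar>cos (pi/2 - real k * pi/2)\<bar> * \<bar>1 - (- 1 :: real) ^ k\<bar> \<le> 4" by (simp add: mult.commute)
        from divide_right_mono[OF this, of "real k"] show ?thesis by (simp add: a_def abs_mult)
      qed
      show "(LINT x|period_measure. cos (of_int \<beta> * pi / 2) * sgn (cos x) * cos (real k * (x - y) - of_int \<beta> * pi / 2)) =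
          a k * cos (real k * y)" if "k \<ge> 1" for k y
        unfolding a_def by (rule square_wave_even[OF sin0 that])
      show "cos (of_int \<beta> * pi / 2) * sgn (cos t) * (kernel r (of_int \<beta>) t - kernel r (of_int \<beta>) (pi/2)) =
          \<bar>kernel r (of_int \<beta>) t - kernel r (of_int \<beta>) (pi/2)\<bar>" if "t \<in> {-pi..pi}" for t
        using kernel_sign_cos[OF r sin0 that] .
    qed (use r p in \<open>auto simp: a_def\<close>)
    then show ?thesis
    proof (rule fin)
      fix j
      have "pi/2 - real (2 * j + 1) * pi/2 = - (real j * pi)" by (simp add: field_simps)
      then have "cos (pi/2 - real (2 * j + 1) * pi/2) = (-1) ^ j" by simp
      \<comment> \<open>For even \<beta> the exponent \<open>j * (\<beta> + 1)\<close> has the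
        parity of \<open>j\<close>.\<close>
      also have "\<dots> = (-1) powi (int j * (\<beta> + 1))"
        using False by (cases "even j") (auto simp: power_int_minus_left_even power_int_minus_left_odd)
      finally show "a (2 * j + 1) = 4 * (-1) powi (int j * (\<beta> + 1)) / real (2 * j + 1)"
        unfolding a_def by simp
    qed
  qed
qed

end

section \<open>Convexity of the multiplier sequences of the two means\<close>

lemma powr_midpoint_convex:
  fixes x y \<mu> :: real
  assumes "\<mu> \<ge> 1" "0 \<le> x" "0 \<le> y"
  shows "((x + y) / 2) powr \<mu> \<le> (x powr \<mu> + y powr \<mu>) / 2"
proof -
  have half: "(z / 2) powr \<mu> \<le> z powr \<mu> / 2" if "z \<ge> 0" for z :: real
  proof -
    have "2 powr 1 \<le> (2::real) powr \<mu>" using assms by (intro powr_mono) auto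
    then show ?thesis
      using that mult_left_mono[of 2 "2 powr \<mu>" "z powr \<mu>"] by (simp add: powr_divide divide_simps)
  qed
  \<comment> \<open>If one argument is 0, the claim reduces to \<open>half\<close>, which rests on
    \<open>2 powr \<mu> \<ge> 2\<close>; convexity of the power is applied to positive
    arguments.\<close>
  consider "x = 0" | "y = 0" | "x > 0" "y > 0" using assms by linarith
  then show ?thesis
  proof cases
    case 3
    then show ?thesis
      using convex_onD[OF powr_convex[OF assms(1)], of "1/2" x y] by (simp add: field_simps)
  qed (use half assms in auto)
qed

text \<open>Convexity of the inverse power \<open>1 / \<alpha>\<close>, applied to
  \<open>x powr \<alpha>\<close> and \<open>y powr \<alpha>\<close>, after raising both sides to the
  power \<alpha>.\<close>

lemma powr_midpoint_concave:
  fixes x y \<alpha> :: real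
  assumes "0 < \<alpha>" "\<alpha> \<le> 1" "0 \<le> x" "0 \<le> y"
  shows "(x powr \<alpha> + y powr \<alpha>) / 2 \<le> ((x + y) / 2) powr \<alpha>"
proof -
  have "((x powr \<alpha> + y powr \<alpha>) / 2) powr (1 / \<alpha>) \<le> (x + y) / 2"
    using powr_midpoint_convex[of "1 / \<alpha>" "x powr \<alpha>" "y powr \<alpha>"] assms by (simp add: powr_powr)
  then have "(((x powr \<alpha> + y powr \<alpha>) / 2) powr (1 / \<alpha>)) powr \<alpha> \<le> ((x + y) / 2) powr \<alpha>"
    using assms by (intro powr_mono2) auto
  then show ?thesis using assms by (simp add: powr_powr)
qed

text \<open>The parameters \<open>v\<close>, \<open>w\<close> cover both means, as \<open>u\<close>,
  1 and as 1, \<delta>. Concavity of \<open>k powr \<alpha>\<close> makes the argument of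
  \<open>pos_part\<close> convex; the positive part and the increasing convex \<open>Q\<close>
  preserve this. The multiplier vanishes once \<open>k powr \<alpha> * w \<ge> v\<close>, which
  gives the cutoff index.\<close>

lemma convex_multiplier_summability:
  fixes Q :: "real \<Rightarrow> real" and v w \<alpha> :: real
  assumes Q0: "Q 0 = 0" and Qv: "Q v > 0"
    and mono: "\<And>x y. 0 \<le> x \<Longrightarrow> x \<le> y \<Longrightarrow> Q x \<le> Q y"
    and convex: "\<And>x y. 0 \<le> x \<Longrightarrow> 0 \<le> y \<Longrightarrow> Q ((x + y) / 2) \<le> (Q x + Q y) / 2"
    and v: "v > 0" and w: "w > 0" and \<alpha>: "0 < \<alpha>" "\<alpha> \<le> 1"
  shows "convex_multiplier (\<lambda>k. Q (pos_part (v - real k powr \<alpha> * w)) / Q v) (nat \<lceil>(v / w) powr (1 / \<alpha>)\<rceil>)"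
proof
  show "Q (pos_part (v - real 0 powr \<alpha> * w)) / Q v = 1" using Qv v by (simp add: pos_part_def)
next
  fix k
  let ?y = "\<lambda>k. pos_part (v - real k powr \<alpha> * w)"
  have "(real k powr \<alpha> + real (Suc (Suc k)) powr \<alpha>) / 2 \<le> ((real k + real (Suc (Suc k))) / 2) powr \<alpha>"
    using \<alpha> by (intro powr_midpoint_concave) auto
  also have "(real k + real (Suc (Suc k))) / 2 = real (Suc k)" by simp
  finally have "(real k powr \<alpha> + real (Suc (Suc k)) powr \<alpha>) / 2 * w \<le> real (Suc k) powr \<alpha> * w"
    using w by (intro mult_right_mono) auto
  then have "?y (Suc k) \<le> (?y k + ?y (Suc (Suc k))) / 2"
    unfolding pos_part_def by (simp add: field_simps)
  then have "Q (?y (Suc k)) \<le> Q ((?y k + ?y (Suc (Suc k))) / 2)"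
    by (intro mono) (auto simp: pos_part_def)
  also have "\<dots> \<le> (Q (?y k) + Q (?y (Suc (Suc k)))) / 2"
    by (intro convex) (auto simp: pos_part_def)
  finally show "2 * (Q (?y (Suc k)) / Q v) \<le> Q (?y k) / Q v + Q (?y (Suc (Suc k))) / Q v"
    using Qv by (simp add: field_simps)
next
  fix k assume "k \<ge> nat \<lceil>(v / w) powr (1 / \<alpha>)\<rceil>"
  then have "(v / w) powr (1 / \<alpha>) \<le> real k" by linarith
  then have "((v / w) powr (1 / \<alpha>)) powr \<alpha> \<le> real k powr \<alpha>" using \<alpha> by (intro powr_mono2) auto
  then have "v \<le> real k powr \<alpha> * w" using \<alpha> v w by (simp add: powr_powr field_simps)
  then show "Q (pos_part (v - real k powr \<alpha> * w)) / Q v = 0" by (simp add: pos_part_def Q0)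
qed

theorem mainTheorem7:
  fixes n :: nat and a \<mu> :: "nat \<Rightarrow> real" and Q :: "real \<Rightarrow> real"
    and \<beta> :: int and p :: ereal and r \<alpha> u \<delta> :: real
  assumes "n \<ge> 1"
    and "\<And>k. k \<in> {1..n} \<Longrightarrow> a k > 0"
    and "\<And>k. k \<in> {1..n} \<Longrightarrow> \<mu> k \<ge> 1"
    and "Q = (\<lambda>x. \<Sum>k=1..n. a k * x powr \<mu> k)"
    and "p = 1 \<or> p = \<infinity>"
    and "0 < \<alpha>" and "\<alpha> \<le> 1" and "u > 0" and "\<delta> > 0"
    and "(odd \<beta> \<and> (r = 1 \<or> r \<ge> 2)) \<or> (even \<beta> \<and> (r = 2 \<or> r \<ge> 3))"
  shows "approx_error (W_class r \<beta> p) (G_mean \<alpha> Q u) p =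
      ereal (4 / pi * (\<Sum>k. (-1) powi (int k * (\<beta> + 1)) / real (2 * k + 1) powr (r + 1)
        * (1 - Q (pos_part (u - real (2 * k + 1) powr \<alpha>)) / Q u)))
    \<and> approx_error (W_class r \<beta> p) (Gt_mean \<alpha> Q \<delta>) p =
      ereal (4 / pi * (\<Sum>k. (-1) powi (int k * (\<beta> + 1)) / real (2 * k + 1) powr (r + 1)
        * (1 - Q (pos_part (1 - real (2 * k + 1) powr \<alpha> * \<delta>)) / Q 1)))"
proof -
  note Q = assms(4)
  \<comment> \<open>Here \<open>0 powr \<mu> k\<close> is 0, so the frequencies cut off by the
    positive part have multiplier 0.\<close>
  have Q0: "Q 0 = 0" by (simp add: Q)
  have mono: "Q x \<le> Q y" if "0 \<le> x" "x \<le> y" for x y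
    unfolding Q using that assms(2,3)
    by (intro sum_mono mult_left_mono powr_mono2) (auto intro: less_imp_le order.trans[of 0 1])
  have pos: "Q x > 0" if "x > 0" for x
    unfolding Q using that assms(1,2) by (intro sum_pos) auto
  have convex: "Q ((x + y) / 2) \<le> (Q x + Q y) / 2" if "0 \<le> x" "0 \<le> y" for x y
  proof -
    have "Q ((x + y) / 2) \<le> (\<Sum>k=1..n. a k * ((x powr \<mu> k + y powr \<mu> k) / 2))"
      unfolding Q using that assms(2,3)
      by (intro sum_mono mult_left_mono powr_midpoint_convex) (auto intro: less_imp_le)
    also have "\<dots> = (Q x + Q y) / 2"
      unfolding Q sum.distrib[symmetric] sum_divide_distrib by (simp add: field_simps)
    finally show ?thesis .
  qed
  \<comment> \<open>Convex sequences are indexed by natural numbers, so the multiplier is first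
    written in \<open>nat \<bar>k\<bar>\<close>; \<open>abs\<close> then restores the form in the
    definitions of the means.\<close>
  have main: "approx_error (W_class r \<beta> p) (\<lambda>f x. \<Sum>\<^sub>\<infinity>k::int.
      complex_of_real (Q (pos_part (v - real (nat \<bar>k\<bar>) powr \<alpha> * w)) / Q v) * fourier_coeff f k * exp (\<i> * k * x)) p =
    ereal (4 / pi * (\<Sum>k. (-1) powi (int k * (\<beta> + 1)) / real (2 * k + 1) powr (r + 1)
        * (1 - Q (pos_part (v - real (2 * k + 1) powr \<alpha> * w)) / Q v)))" if "v > 0" "w > 0" for v w
    using convex_multiplier.approx_error_multiplier[OF
        convex_multiplier_summability[OF Q0 pos[OF that(1)] mono convex that assms(6,7)] assms(5,10)] .
  have abs: "real (nat \<bar>k\<bar>) = \<bar>real_of_int k\<bar>" for k by simp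
  show ?thesis
    unfolding G_mean_def[abs_def] Gt_mean_def[abs_def]
    using main[OF assms(8), of 1] main[of 1 \<delta>] assms(9) unfolding abs by simp
qed

end
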